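(* There is a constant $C>0$, independent of $\varepsilon,\delta,H$ and of $f$, such that the following holds. Let $f\in L^2(\Omega)$, let $u\in H^1_P(\Omega)$ be the solution of the stationary problem $a(u,v)=(f,v)$ for all $v\in H^1_P(\Omega)$, and let $u_H\in\Psi_H$ be the Galerkin approximation, i.e. $a(u_H,v_H)=(f,v_H)$ for all $v_H\in\Psi_H$. Then $$\|u-u_H\|_e\le C\frac{H}{\varepsilon}\|f\|,\qquad \|u-u_H\|\le C\frac{H^2}{\varepsilon^2}\|f\|.$$ Moreover, if $f\in H^1(\Omega)$, then $$\|u-u_H\|_e\le C\frac{H^2}{\varepsilon}\|\nabla f\|,\qquad \|u-u_H\|\le C\frac{H^3}{\varepsilon^2}\|\nabla f\|.$$
   Context: Setting. $\Omega=[0,2\pi]^d$; functions are complex-valued; $(v,w)=\int_\Omega v\bar w$, $\|\cdot\|$ is the $L^2(\Omega)$ norm, $\|\cdot\|_K$ the $L^2(K)$ norm for $K\subset\Omega$; $H^1_P(\Omega)=\{w\in H^1(\Omega): w \text{ is periodic on }\partial\Omega\}$. The small parameters satisfy $0<\varepsilon\ll1$, $0<\delta\ll1$. $V=V^\delta$ is a real potential with $V_{\min}\le V\le V_{\max}$ on $\Omega$, where $0<V_{\min}\le V_{\max}$ do not depend on $\varepsilon,\delta$, and $\|D^{\sigma}_xV\|_\infty\le C\delta^{-|\sigma|}$ for multi-indices $\sigma$. Set $a(v,w)=\frac12\varepsilon^2(\nabla v,\nabla w)+(Vv,w)$ and $\|w\|_e=a(w,w)^{1/2}$. The variational problem above is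 the weak form of $-\frac12\varepsilon^2\Delta u+Vu=f$ with periodic boundary conditions. Mesh. $\mathcal T_H$ is a quasi-uniform, shape-regular simplicial mesh of $\Omega$ of mesh size $H$, compatible with the periodic boundary conditions (opposite faces of $\Omega$ are identified). For a union $K$ of elements, $N(K)=\bigcup\{G\in\mathcal T_H: G\cap K\ne\emptyset\}$, $N^0(K)=K$, $N^{m+1}(K)=N(N^m(K))$. $\Phi_H\subset H^1_P(\Omega)$ is the space of functions that are polynomials of degree $\le1$ on each element, with nodal basis $\phi_1,\dots,\phi_{N_H}$ (one for each vertex, vertices identified by periodicity being counted once). The Clément-type interpolation is $I_Hv=\sum_{j=1}^{N_H}\frac{(v,\phi_j)}{(1,\phi_j)}\phi_j$ for $v\in H^1_P(\Omega)$. Constants, independent of $\varepsilon,\delta,m,H$: $C_{\rm ol}$ with $\max_{T\in\mathcal T_H}\mathrm{card}\{G\in\mathcal T_H: G\subset N(T)\}\le C_{\rm ol}$; $C_{I_H}$ with $H^{-1}\|v-I_Hv\|_T+\|\nabla(v-I_Hv)\|_T\le C_{I_H}\|\nabla v\|_{N(T)}$ for all $T\in\mathcal T_H$, $v\in H^1_P(\Omega)$; $\gamma$ with $H\|\nabla\eta\|_\infty\le\gamma$ for all cutoffs $\eta(x)=\frac{\mathrm{dist}(x,N^m(K))}{\mathrm{dist}(x,N^m(K))+\mathrm{dist}(x,\Omega\setminus N^{m+1}(K))}$. Standing resolution assumption: $H/\varepsilon\le\left(2C_{I_H}\sqrt{C_{\rm ol}V_{\max}(1+C_{I_H}C_{\rm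 ol}\gamma)}\right)^{-1}$. Multiscale space: $\psi_j$ ($j=1,\dots,N_H$) is the minimizer of $a(\psi,\psi)$ over $\psi\in H^1_P(\Omega)$ subject to $(\psi,\phi_k)=\delta_{jk}$ (Kronecker delta), $k=1,\dots,N_H$; $\Psi_H=\mathrm{span}\{\psi_1,\dots,\psi_{N_H}\}$.
   Formalization: The last two estimates are proved for f in H^1_P(Ω) (periodic f) instead of all f in H^1(Ω); for non-periodic f they fail, e.g. d=1, V=1, f(x)=x on a uniform mesh, where the energy error is at least of order H^{3/2}/ε. *)

theory Defs
  imports "HOL-Analysis.Analysis"
begin

definition Omega :: "(real^'n) set" where
  "Omega = cbox 0 (\<chi> i. 2 * pi)"

definition partial :: "'n \<Rightarrow> (real^'n \<Rightarrow> 'b::real_normed_vector) \<Rightarrow> real^'n \<Rightarrow> 'b" where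
  "partial i f x = frechet_derivative f (at x) (axis i 1)"

text \<open>A multi-index of order \<open>m\<close> is represented by a list of \<open>m\<close> coordinate directions; for smooth
  functions the order of the list is immaterial.\<close>

fun partials :: "'n list \<Rightarrow> (real^'n \<Rightarrow> 'b::real_normed_vector) \<Rightarrow> real^'n \<Rightarrow> 'b" where
  "partials [] f = f"
| "partials (i # \<sigma>) f = partial i (partials \<sigma> f)"

text \<open>Intended for open \<open>S\<close>.\<close>

definition smooth_on :: "(real^'n) set \<Rightarrow> (real^'n \<Rightarrow> 'b::real_normed_vector) \<Rightarrow> bool" where
  "smooth_on S f \<longleftrightarrow> (\<forall>\<sigma>. partials \<sigma> f differentiable_on S)"

definition test_function :: "(real^'n \<Rightarrow> real) \<Rightarrow> bool" where
  "test_function \<theta> \<longleftrightarrow> smooth_on UNIV \<theta> \<and>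
     (\<exists>K. compact K \<and> K \<subseteq> interior Omega \<and> (\<forall>x. x \<notin> K \<longrightarrow> \<theta> x = 0))"

text \<open>Members of \<open>L2 S\<close> are functions, not classes modulo null sets. Their values outside \<open>S\<close> are
  irrelevant.\<close>

definition L2 :: "(real^'n) set \<Rightarrow> (real^'n \<Rightarrow> 'b::euclidean_space) set" where
  "L2 S = {f. f \<in> borel_measurable (lebesgue_on S) \<and>
              integrable (lebesgue_on S) (\<lambda>x. (norm (f x))\<^sup>2)}"

definition L2norm :: "(real^'n) set \<Rightarrow> (real^'n \<Rightarrow> 'b::euclidean_space) \<Rightarrow> real" where
  "L2norm S f = sqrt (LINT x|lebesgue_on S. (norm (f x))\<^sup>2)"

definition L2inner :: "(real^'n \<Rightarrow> complex) \<Rightarrow> (real^'n \<Rightarrow> complex) \<Rightarrow> complex" where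
  "L2inner v w = (LINT x|lebesgue_on Omega. v x * cnj (w x))"

definition L2inner_vec :: "(real^'n \<Rightarrow> complex^'n) \<Rightarrow> (real^'n \<Rightarrow> complex^'n) \<Rightarrow> complex" where
  "L2inner_vec v w = (LINT x|lebesgue_on Omega. (\<Sum>i\<in>UNIV. v x $ i * cnj (w x $ i)))"

definition weak_gradient :: "(real^'n \<Rightarrow> complex) \<Rightarrow> (real^'n \<Rightarrow> complex^'n) \<Rightarrow> bool" where
  "weak_gradient w g \<longleftrightarrow> (\<forall>\<theta> i. test_function \<theta> \<longrightarrow>
     (LINT x|lebesgue_on Omega. partial i \<theta> x *\<^sub>R w x)
       = - (LINT x|lebesgue_on Omega. \<theta> x *\<^sub>R (g x $ i)))"

definition H1 :: "(real^'n \<Rightarrow> complex) set" where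
  "H1 = {w \<in> L2 Omega. \<exists>g \<in> L2 Omega. weak_gradient w g}"

text \<open>Determined almost everywhere on \<open>Omega\<close> for \<open>w \<in> H1\<close>.\<close>

definition grad :: "(real^'n \<Rightarrow> complex) \<Rightarrow> real^'n \<Rightarrow> complex^'n" where
  "grad w = (SOME g. g \<in> L2 Omega \<and> weak_gradient w g)"

text \<open>The trace of \<open>w \<in> H1\<close> on the face \<open>x $ i = c\<close> (with \<open>c = 0\<close> or \<open>c = 2 * pi\<close>) is the continuous
  extension of the restriction operator for functions smooth up to the boundary. A function on the
  face is represented by the function on \<open>Omega\<close> that does not depend on the \<open>i\<close>-th coordinate; its
  norm in \<open>L2 Omega\<close> is \<open>sqrt (2 * pi)\<close> times the \<open>L2\<close> norm on the face.\<close>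

definition to_face :: "'n \<Rightarrow> real \<Rightarrow> real^'n \<Rightarrow> real^'n" where
  "to_face i c x = (\<chi> j. if j = i then c else x $ j)"

definition has_trace :: "(real^'n \<Rightarrow> complex) \<Rightarrow> 'n \<Rightarrow> real \<Rightarrow> (real^'n \<Rightarrow> complex) \<Rightarrow> bool" where
  "has_trace w i c \<tau> \<longleftrightarrow> \<tau> \<in> L2 Omega \<and>
     (\<exists>s :: nat \<Rightarrow> real^'n \<Rightarrow> complex. (\<forall>n. smooth_on UNIV (s n)) \<and>
        (\<lambda>n. L2norm Omega (\<lambda>x. s n x - w x)) \<longlonglongrightarrow> 0 \<and>
        (\<lambda>n. L2norm Omega (\<lambda>x. (\<chi> j. partial j (s n) x) - grad w x)) \<longlonglongrightarrow> 0 \<and>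
        (\<lambda>n. L2norm Omega (\<lambda>x. s n (to_face i c x) - \<tau> x)) \<longlonglongrightarrow> 0)"

text \<open>This is the Sobolev space of the torus. The higher order error estimates for a regular right-hand
  side \<open>f\<close> need \<open>f \<in> H1P\<close>: if \<open>f\<close> has a jump across the identified faces of \<open>Omega\<close>, they fail even
  when \<open>f \<in> H1\<close>.\<close>

definition H1P :: "(real^'n \<Rightarrow> complex) set" where
  "H1P = {w \<in> H1. \<forall>i. \<exists>\<tau>. has_trace w i 0 \<tau> \<and> has_trace w i (2 * pi) \<tau>}"

definition aform :: "real \<Rightarrow> (real^'n \<Rightarrow> real) \<Rightarrow> (real^'n \<Rightarrow> complex) \<Rightarrow> (real^'n \<Rightarrow> complex) \<Rightarrow> complex"
  where
  "aform \<epsilon> V v w = of_real (\<epsilon>\<^sup>2 / 2) * L2inner_vec (grad v) (grad w)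
                   + L2inner (\<lambda>x. of_real (V x) * v x) w"

text \<open>\<open>aform \<epsilon> V w w\<close> is real; \<open>Re\<close> only changes its type.\<close>

definition energy_norm :: "real \<Rightarrow> (real^'n \<Rightarrow> real) \<Rightarrow> (real^'n \<Rightarrow> complex) \<Rightarrow> real" where
  "energy_norm \<epsilon> V w = sqrt (Re (aform \<epsilon> V w w))"

definition potential ::
  "real \<Rightarrow> real \<Rightarrow> (nat \<Rightarrow> real) \<Rightarrow> real \<Rightarrow> (real^'n \<Rightarrow> real) \<Rightarrow> bool" where
  "potential Vmin Vmax CV \<delta> V \<longleftrightarrow>
     (\<forall>x\<in>Omega. Vmin \<le> V x \<and> V x \<le> Vmax) \<and>
     smooth_on (interior Omega) V \<and>
     (\<forall>\<sigma>. \<forall>x\<in>interior Omega. \<bar>partials \<sigma> V x\<bar> \<le> CV (length \<sigma>) / \<delta> ^ length \<sigma>)"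

text \<open>All points equal to a point of \<open>A\<close> modulo the periods. Points of \<open>Omega\<close> on opposite faces are
  identified, so adjacency of elements and distances are those of the torus.\<close>

definition periodic_hull :: "(real^'n) set \<Rightarrow> (real^'n) set" where
  "periodic_hull A = {x. \<exists>y\<in>A. \<forall>i. (x $ i - y $ i) / (2 * pi) \<in> \<int>}"

definition torus_dist :: "real^'n \<Rightarrow> (real^'n) set \<Rightarrow> real" where
  "torus_dist x A = infdist x (periodic_hull A)"

text \<open>The last condition says that the mesh remains face-to-face after periodic continuation.\<close>

definition periodic_mesh :: "(real^'n) set set \<Rightarrow> bool" where
  "periodic_mesh \<T> \<longleftrightarrow>
     triangulation \<T> \<and> (\<forall>T\<in>\<T>. int CARD('n) simplex T) \<and> \<Union>\<T> = Omega \<and>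
     (\<forall>T\<in>\<T>. \<forall>S\<in>\<T>. \<forall>k. (\<forall>i. k $ i \<in> \<int>) \<longrightarrow>
        (let S' = (\<lambda>x. x + (2 * pi) *\<^sub>R k) ` S in T \<inter> S' face_of T \<and> T \<inter> S' face_of S'))"

definition mesh_size :: "(real^'n) set set \<Rightarrow> real" where
  "mesh_size \<T> = Max (diameter ` \<T>)"

definition shape_regular :: "real \<Rightarrow> (real^'n) set set \<Rightarrow> bool" where
  "shape_regular \<kappa> \<T> \<longleftrightarrow> (\<forall>T\<in>\<T>. \<exists>x. cball x (diameter T / \<kappa>) \<subseteq> T)"

definition quasi_uniform :: "real \<Rightarrow> (real^'n) set set \<Rightarrow> bool" where
  "quasi_uniform q \<T> \<longleftrightarrow> (\<forall>T\<in>\<T>. mesh_size \<T> \<le> q * diameter T)"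

definition nbhd :: "(real^'n) set set \<Rightarrow> (real^'n) set \<Rightarrow> (real^'n) set" where
  "nbhd \<T> K = \<Union>{G \<in> \<T>. periodic_hull G \<inter> periodic_hull K \<noteq> {}}"

definition overlap_bound :: "real \<Rightarrow> (real^'n) set set \<Rightarrow> bool" where
  "overlap_bound Col \<T> \<longleftrightarrow> (\<forall>T\<in>\<T>. real (card {G \<in> \<T>. G \<subseteq> nbhd \<T> T}) \<le> Col)"

definition cutoff :: "(real^'n) set set \<Rightarrow> (real^'n) set \<Rightarrow> nat \<Rightarrow> real^'n \<Rightarrow> real" where
  "cutoff \<T> K m x =
     (let d0 = torus_dist x ((nbhd \<T> ^^ m) K);
          d1 = torus_dist x (Omega - (nbhd \<T> ^^ Suc m) K)
      in d0 / (d0 + d1))"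

text \<open>The case where the \<open>(m+1)\<close>-st neighbourhood is all of \<open>Omega\<close> is left out: there the distance to
  the empty set is to be read as infinite and the cutoff vanishes, whereas \<open>infdist x {} = 0\<close>.\<close>

definition cutoff_bound :: "real \<Rightarrow> (real^'n) set set \<Rightarrow> bool" where
  "cutoff_bound \<gamma> \<T> \<longleftrightarrow>
     (\<forall>\<S> m. \<S> \<subseteq> \<T> \<longrightarrow> \<S> \<noteq> {} \<longrightarrow> Omega - (nbhd \<T> ^^ Suc m) (\<Union>\<S>) \<noteq> {} \<longrightarrow>
        (AE x in lebesgue_on Omega.
           mesh_size \<T> * norm (grad (\<lambda>y. of_real (cutoff \<T> (\<Union>\<S>) m y)) x) \<le> \<gamma>))"

definition vertices :: "(real^'n) set set \<Rightarrow> (real^'n) set" where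
  "vertices \<T> = {z. \<exists>T\<in>\<T>. z extreme_point_of T}"

text \<open>One representative of each vertex modulo the periods; this set indexes the nodal basis.\<close>

definition nodes :: "(real^'n) set set \<Rightarrow> (real^'n) set" where
  "nodes \<T> = {z \<in> vertices \<T>. \<forall>i. z $ i < 2 * pi}"

definition PhiH :: "(real^'n) set set \<Rightarrow> (real^'n \<Rightarrow> complex) set" where
  "PhiH \<T> = {v \<in> H1P. \<forall>T\<in>\<T>. \<exists>a b. \<forall>x\<in>T. v x = a + (\<Sum>i\<in>UNIV. b $ i * of_real (x $ i))}"

definition nodal_basis :: "(real^'n) set set \<Rightarrow> (real^'n \<Rightarrow> real^'n \<Rightarrow> complex) \<Rightarrow> bool" where
  "nodal_basis \<T> \<phi> \<longleftrightarrow> (\<forall>z\<in>nodes \<T>. \<phi> z \<in> PhiH \<T> \<and>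
     (\<forall>z'\<in>vertices \<T>. \<phi> z z' = (if z' \<in> periodic_hull {z} then 1 else 0)))"

definition interp ::
  "(real^'n) set set \<Rightarrow> (real^'n \<Rightarrow> real^'n \<Rightarrow> complex) \<Rightarrow> (real^'n \<Rightarrow> complex) \<Rightarrow> real^'n \<Rightarrow> complex"
  where
  "interp \<T> \<phi> v x = (\<Sum>z\<in>nodes \<T>. L2inner v (\<phi> z) / L2inner (\<lambda>_. 1) (\<phi> z) * \<phi> z x)"

definition interp_bound ::
  "real \<Rightarrow> (real^'n) set set \<Rightarrow> (real^'n \<Rightarrow> real^'n \<Rightarrow> complex) \<Rightarrow> bool" where
  "interp_bound CI \<T> \<phi> \<longleftrightarrow> (\<forall>T\<in>\<T>. \<forall>v\<in>H1P.
     L2norm T (\<lambda>x. v x - interp \<T> \<phi> v x) / mesh_size \<T>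
       + L2norm T (grad (\<lambda>x. v x - interp \<T> \<phi> v x))
     \<le> CI * L2norm (nbhd \<T> T) (grad v))"

definition dual_to ::
  "(real^'n) set set \<Rightarrow> (real^'n \<Rightarrow> real^'n \<Rightarrow> complex) \<Rightarrow> real^'n \<Rightarrow> (real^'n \<Rightarrow> complex) set" where
  "dual_to \<T> \<phi> z =
     {\<xi> \<in> H1P. \<forall>z'\<in>nodes \<T>. L2inner \<xi> (\<phi> z') = (if z' = z then 1 else 0)}"

definition multiscale_basis ::
  "real \<Rightarrow> (real^'n \<Rightarrow> real) \<Rightarrow> (real^'n) set set \<Rightarrow> (real^'n \<Rightarrow> real^'n \<Rightarrow> complex) \<Rightarrow>
     (real^'n \<Rightarrow> real^'n \<Rightarrow> complex) \<Rightarrow> bool" where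
  "multiscale_basis \<epsilon> V \<T> \<phi> \<psi> \<longleftrightarrow>
     (\<forall>z\<in>nodes \<T>. is_arg_min (\<lambda>\<xi>. Re (aform \<epsilon> V \<xi> \<xi>)) (\<lambda>\<xi>. \<xi> \<in> dual_to \<T> \<phi> z) (\<psi> z))"

definition PsiH ::
  "(real^'n) set set \<Rightarrow> (real^'n \<Rightarrow> real^'n \<Rightarrow> complex) \<Rightarrow> (real^'n \<Rightarrow> complex) set" where
  "PsiH \<T> \<psi> = {(\<lambda>x. \<Sum>z\<in>nodes \<T>. c z * \<psi> z x) | c. True}"

end

theory Submission
  imports Defs
begin

text \<open>Let \<open>W\<close> be the set of functions in \<open>H1P\<close> that are \<open>L2\<close>-orthogonal to the nodal basis; the
  interpolation vanishes on \<open>W\<close>. By minimality every \<open>\<psi> z\<close> is \<open>a\<close>-orthogonal to \<open>W\<close>, and subtracting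
  the combination of the \<open>\<psi> z\<close> with the moments of \<open>v\<close> as coefficients moves any \<open>v\<close> into \<open>W\<close>.
  So Galerkin orthogonality forces the error \<open>e\<close> into \<open>W\<close>, and \<open>a(e, e) = (f, e)\<close>. Since \<open>e\<close> is its
  own interpolation error, \<open>\<parallel>e\<parallel> \<le> c H \<parallel>\<nabla>e\<parallel> \<le> c (H / \<epsilon>) \<parallel>e\<parallel>\<^sub>e\<close>, which gives both estimates without a duality
  argument. For \<open>f \<in> H1P\<close> one more power of \<open>H\<close> comes from replacing \<open>f\<close> by \<open>f\<close> minus its
  interpolation, which does not change \<open>(f, e)\<close>. Linearity of the form rests on the uniqueness of the
  weak gradient, which is proved by testing with smooth bumps that approximate indicators of boxes.\<close>

section \<open>Bumps on boxes\<close>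

text \<open>\<open>flat k\<close> is the \<open>k\<close>-th derivative of \<open>exp (- 1 / x)\<close>, extended by \<open>0\<close> to \<open>x \<le> 0\<close>.\<close>

primrec flat_poly :: "nat \<Rightarrow> real poly" where
  "flat_poly 0 = 1"
| "flat_poly (Suc k) = [:0, 0, 1:] * (flat_poly k - pderiv (flat_poly k))"

definition flat :: "nat \<Rightarrow> real \<Rightarrow> real" where
  "flat k x = (if 0 < x then poly (flat_poly k) (inverse x) * exp (- inverse x) else 0)"

text \<open>The exponential beats every power of x. Evaluated at \<open>inverse y\<close> as y tends
  to 0 from the right, this is the flatness of every \<open>flat k\<close> at the origin.\<close>

lemma poly_times_exp_minus_at_top:
  fixes p :: "real poly"
  shows "((\<lambda>x. poly p x * exp (- x)) \<longlongrightarrow> 0) at_top"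
proof -
  have "((\<lambda>x. \<Sum>i\<le>degree p. coeff p i * (x ^ i / exp x)) \<longlongrightarrow> (\<Sum>i\<le>degree p. coeff p i * 0)) at_top"
    by (intro tendsto_intros tendsto_power_div_exp_0)
  then show ?thesis
    by (simp add: poly_altdef sum_distrib_right exp_minus divide_inverse mult.assoc)
qed

text \<open>For x > 0 the product and chain rules give x^(-2) (p - p')(1/x) exp(-1/x) with p =
  \<open>flat_poly k\<close>, which is the source of the recursion for \<open>flat_poly\<close>. At
  0 the difference quotient is examined from each side separately.\<close>

lemma flat_has_real_derivative: "(flat k has_real_derivative flat (Suc k) x) (at x)"
proof -
  consider "x > 0" | "x < 0" | "x = 0" by linarith
  then show ?thesis
  proof cases
    case 1
    have "((\<lambda>x. poly (flat_poly k) (inverse x) * exp (- inverse x)) has_real_derivative flat (Suc k) x) (at x)"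
      using 1 by (auto intro!: derivative_eq_intros poly_DERIV[THEN DERIV_chain2]
          simp: flat_def field_simps power2_eq_square)
    then show ?thesis
      by (rule has_field_derivative_transform_within_open[where S="{0<..}"]) (use 1 in \<open>auto simp: flat_def\<close>)
  next
    case 2
    have "((\<lambda>x. 0) has_real_derivative 0) (at x)" by simp
    then have "(flat k has_real_derivative 0) (at x)"
      by (rule has_field_derivative_transform_within_open[where S="{..<0}"]) (use 2 in \<open>auto simp: flat_def\<close>)
    then show ?thesis using 2 by (simp add: flat_def)
  next
    case 3
    have "((\<lambda>y. flat k y / y) \<longlongrightarrow> 0) (at 0)"
    proof (rule filterlim_split_at)
      have "((\<lambda>y. 0::real) \<longlongrightarrow> 0) (at_left 0)" by simp
      then show "((\<lambda>y. flat k y / y) \<longlongrightarrow> 0) (at_left 0)"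
        by (rule Lim_transform_eventually) (auto simp: eventually_at_filter flat_def)
      \<comment> \<open>Dividing by y in the difference quotient multiplies by
        \<open>inverse y\<close>, hence the extra polynomial factor \<open>[:0, 1:]\<close>.\<close>
      have "((\<lambda>y. poly ([:0, 1:] * flat_poly k) (inverse y) * exp (- inverse y)) \<longlongrightarrow> 0) (at_right 0)"
        by (rule filterlim_compose[OF poly_times_exp_minus_at_top filterlim_inverse_at_top_right])
      then show "((\<lambda>y. flat k y / y) \<longlongrightarrow> 0) (at_right 0)"
        by (rule Lim_transform_eventually) (auto simp: eventually_at_filter flat_def field_simps)
    qed
    then show ?thesis
      using 3 by (simp add: has_field_derivative_iff flat_def)
  qed
qed

text \<open>An algebra of functions that is closed under partial derivatives consists of smooth functions;
  this replaces a Leibniz formula for products of bumps.\<close>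

inductive_set flat_algebra :: "(real^'n \<Rightarrow> real) set" where
  const: "(\<lambda>_. c) \<in> flat_algebra"
| flat: "(\<lambda>x. flat k (a * x $ i + b)) \<in> flat_algebra"
| add: "f \<in> flat_algebra \<Longrightarrow> g \<in> flat_algebra \<Longrightarrow> (\<lambda>x. f x + g x) \<in> flat_algebra"
| mult: "f \<in> flat_algebra \<Longrightarrow> g \<in> flat_algebra \<Longrightarrow> (\<lambda>x. f x * g x) \<in> flat_algebra"

lemma partial_eqI:
  assumes "\<And>x. (f has_derivative f' x) (at x)"
  shows "partial i f = (\<lambda>x. f' x (axis i 1))"
  using frechet_derivative_at[OF assms] by (auto simp: partial_def fun_eq_iff)

text \<open>The chain rule turns \<open>flat k\<close> of an affine coordinate function into
  \<open>flat (Suc k)\<close> times a constant, and the sum and product rules stay in the algebra.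
  Differentiability is part of the induction because those rules require it of both
  operands.\<close>

lemma flat_algebra_partial:
  assumes "f \<in> flat_algebra"
  shows "(\<forall>x. f differentiable (at x)) \<and> partial i f \<in> flat_algebra"
  using assms
proof induction
  case (const c)
  have "partial i (\<lambda>_. c :: real) = (\<lambda>_. 0)"
    by (rule partial_eqI) (rule has_derivative_const)
  then show ?case using flat_algebra.const[of 0] by simp
next
  case (flat k a j b)
  have 1: "((\<lambda>x. flat k (a * x $ j + b)) has_derivative
      (\<lambda>h. flat (Suc k) (a * x $ j + b) * (a * h $ j))) (at x)" for x :: "real^'a"
    by (rule has_derivative_eq_rhs[OF has_derivative_compose[OF _
            flat_has_real_derivative[unfolded has_field_derivative_def]]])
       (auto intro!: derivative_eq_intros bounded_linear_imp_has_derivative bounded_linear_vec_nth)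
  have "partial i (\<lambda>x. flat k (a * x $ j + b)) =
     (\<lambda>x. flat (Suc k) (a * x $ j + b) * (a * axis i 1 $ j))"
    by (rule partial_eqI) (rule 1)
  also have "\<dots> \<in> flat_algebra"
    by (intro flat_algebra.mult flat_algebra.flat flat_algebra.const)
  finally show ?case using 1 by (auto simp: differentiable_def)
next
  case (add f g)
  have 1: "(f has_derivative frechet_derivative f (at x)) (at x)"
       "(g has_derivative frechet_derivative g (at x)) (at x)" for x
    using add.IH frechet_derivative_works by blast+
  have "partial i (\<lambda>x. f x + g x) = (\<lambda>x. partial i f x + partial i g x)"
    unfolding partial_def[of i f] partial_def[of i g]
    by (rule partial_eqI) (intro has_derivative_add 1)
  then show ?case using add by (auto intro: flat_algebra.add differentiable_add)
next
  case (mult f g)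
  have 1: "(f has_derivative frechet_derivative f (at x)) (at x)"
       "(g has_derivative frechet_derivative g (at x)) (at x)" for x
    using mult.IH frechet_derivative_works by blast+
  have "partial i (\<lambda>x. f x * g x) = (\<lambda>x. f x * partial i g x + partial i f x * g x)"
    unfolding partial_def[of i f] partial_def[of i g]
    by (rule partial_eqI) (intro has_derivative_mult 1)
  then show ?case using mult by (auto intro: flat_algebra.intros differentiable_mult)
qed

lemma smooth_on_flat_algebra:
  assumes "f \<in> flat_algebra"
  shows "smooth_on S f"
proof -
  have "partials \<sigma> f \<in> flat_algebra" for \<sigma>
    by (induction \<sigma>) (use assms flat_algebra_partial in auto)
  then show ?thesis
    by (meson smooth_on_def differentiable_on_def flat_algebra_partial differentiable_at_withinI)
qed

lemma flat_algebra_prod: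
  "finite I \<Longrightarrow> (\<And>i. i \<in> I \<Longrightarrow> f i \<in> flat_algebra) \<Longrightarrow> (\<lambda>x. \<Prod>i\<in>I. f i x) \<in> flat_algebra"
  by (induction I rule: finite_induct) (auto intro: flat_algebra.intros)

lemma flat_0_bounds: "0 \<le> flat 0 x" "flat 0 x \<le> 1"
  by (auto simp: flat_def)

lemma flat_0_tendsto_1:
  assumes "t > 0"
  shows "(\<lambda>m. flat 0 (real m * t - 1)) \<longlonglongrightarrow> 1"
proof -
  have f: "filterlim (\<lambda>m. real m * t - 1) at_top sequentially"
    using assms by (intro filterlim_tendsto_add_at_top[OF tendsto_const, of _ _ "-1", simplified])
      (auto intro!: filterlim_at_top_mult_tendsto_pos[OF tendsto_const] filterlim_real_sequentially)
  have "((\<lambda>y::real. exp (- inverse y)) \<longlongrightarrow> exp (- 0)) at_top"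
    by (intro tendsto_intros tendsto_inverse_0_at_top filterlim_ident)
  then have "(flat 0 \<longlongrightarrow> 1) at_top"
    by (simp add: Lim_transform_eventually eventually_at_top_linorder flat_def)
       (erule Lim_transform_eventually, rule eventually_mono[OF eventually_gt_at_top[of 0]], simp add: flat_def)
  from filterlim_compose[OF this f] show ?thesis .
qed

text \<open>The shift by -1 makes a factor vanish within distance 1/m of its face, which keeps the
  support compactly inside the box. The slope m makes each factor tend to 1 at interior
  points.\<close>

definition box_bump :: "real^'n \<Rightarrow> real^'n \<Rightarrow> nat \<Rightarrow> real^'n \<Rightarrow> real" where
  "box_bump a b m x =
     (\<Prod>i\<in>UNIV. flat 0 (real m * (x $ i - a $ i) - 1) * flat 0 (real m * (b $ i - x $ i) - 1))"

lemma box_bump_in_flat_algebra: "box_bump a b m \<in> flat_algebra"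
proof -
  have "(\<lambda>x. flat 0 (real m * (x $ i - a $ i) - 1) * flat 0 (real m * (b $ i - x $ i) - 1)) \<in> flat_algebra"
    for i
    using flat_algebra.mult[OF flat_algebra.flat[of 0 "real m" i "- real m * a $ i - 1"]
        flat_algebra.flat[of 0 "- real m" i "real m * b $ i - 1"]]
    by (simp add: algebra_simps)
  then show ?thesis
    unfolding box_bump_def[abs_def] by (intro flat_algebra_prod) auto
qed

lemma box_bump_bounds: "0 \<le> box_bump a b m x" "box_bump a b m x \<le> 1"
  unfolding box_bump_def
  by (auto intro!: prod_nonneg prod_le_1 mult_nonneg_nonneg mult_le_one simp: flat_0_bounds)

lemma box_bump_eq_0:
  assumes "x \<notin> cbox (\<chi> i. a $ i + 1 / real (Suc m)) (\<chi> i. b $ i - 1 / real (Suc m))"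
  shows "box_bump a b (Suc m) x = 0"
proof -
  from assms obtain i where "x $ i < a $ i + 1 / real (Suc m) \<or> x $ i > b $ i - 1 / real (Suc m)"
    by (auto simp: mem_box_cart not_le)
  then have "real (Suc m) * (x $ i - a $ i) - 1 \<le> 0 \<or> real (Suc m) * (b $ i - x $ i) - 1 \<le> 0"
    by (auto simp: field_simps simp del: of_nat_Suc)
  then show ?thesis
    unfolding box_bump_def by (intro prod_zero bexI[of _ i]) (auto simp: flat_def simp del: of_nat_Suc)
qed

lemma interior_Omega: "interior (Omega :: (real^'n) set) = box 0 (\<chi> i. 2 * pi)"
  by (simp add: Omega_def)

text \<open>The index is \<open>Suc m\<close> so that the margin \<open>1 / real (Suc m)\<close> is
  positive and the closed box lies in the open one.\<close>

lemma box_bump_support: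
  "cbox (\<chi> i. a $ i + 1 / real (Suc m)) (\<chi> i. b $ i - 1 / real (Suc m)) \<subseteq> box a b"
proof
  fix x assume "x \<in> cbox (\<chi> i. a $ i + 1 / real (Suc m)) (\<chi> i. b $ i - 1 / real (Suc m))"
  then have "a $ i + 1 / real (Suc m) \<le> x $ i \<and> x $ i \<le> b $ i - 1 / real (Suc m)" for i
    by (simp add: mem_box_cart)
  moreover have "0 < 1 / real (Suc m)" by simp
  ultimately have "a $ i < x $ i \<and> x $ i < b $ i" for i
    by (meson add_less_cancel_left diff_less_eq less_add_same_cancel1 le_less_trans less_le_trans)
  then show "x \<in> box a b"
    by (simp add: mem_box_cart)
qed

lemma test_function_box_bump:
  assumes "box a b \<subseteq> interior (Omega :: (real^'n) set)"
  shows "test_function (box_bump a b (Suc m))"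
  unfolding test_function_def
proof (intro conjI exI allI impI)
  let ?K = "cbox (\<chi> i. a $ i + 1 / real (Suc m)) (\<chi> i. b $ i - 1 / real (Suc m))"
  show "smooth_on UNIV (box_bump a b (Suc m))"
    by (rule smooth_on_flat_algebra[OF box_bump_in_flat_algebra])
  show "compact ?K" by simp
  show "?K \<subseteq> interior Omega" using assms box_bump_support[of a m b] by auto
qed (rule box_bump_eq_0)

text \<open>Inside the box finitely many factors each tend to 1; outside, every bump is already 0.
  Together with \<open>box_bump_bounds\<close> this prepares dominated convergence.\<close>

lemma box_bump_tendsto:
  "(\<lambda>m. box_bump a b (Suc m) x) \<longlonglongrightarrow> indicator (box a b) x"
proof (cases "x \<in> box a b")
  case True
  have "(\<lambda>m. box_bump a b m x) \<longlonglongrightarrow> (\<Prod>i\<in>(UNIV::'a set). 1 * 1)"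
    unfolding box_bump_def
    using True by (intro tendsto_prod tendsto_mult flat_0_tendsto_1) (auto simp: mem_box_cart)
  then show ?thesis using True LIMSEQ_Suc by fastforce
next
  case False
  then have "x \<notin> cbox (\<chi> i. a $ i + 1 / real (Suc m)) (\<chi> i. b $ i - 1 / real (Suc m))" for m
    using box_bump_support[of a m b] by blast
  then show ?thesis using False by (simp add: box_bump_eq_0 del: of_nat_Suc)
qed

section \<open>Uniqueness of the weak gradient\<close>

text \<open>Open boxes form an intersection-stable generator of the Borel sets, so vanishing of the
  integral spreads from boxes to Borel sets, then to Lebesgue sets. Integrating over the sets where
  h is positive or negative finishes the proof.\<close>

lemma AE_eq_0_if_box_integrals_eq_0:
  fixes h :: "'a::euclidean_space \<Rightarrow> real"
  assumes h: "integrable lebesgue h"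
    and box: "\<And>a b. (LINT x:box a b|lebesgue. h x) = 0"
  shows "AE x in lebesgue. h x = 0"
proof -
  have seth: "set_integrable lebesgue A h" if "A \<in> sets lebesgue" for A
    using integrable_mult_indicator[OF that h] by (simp add: set_integrable_def)
  \<comment> \<open>The whole space is exhausted by growing boxes; its integral is needed for the
    complement case of the induction.\<close>
  have UNIV0: "(LINT x:UNIV|lebesgue. h x) = 0"
  proof -
    have "(\<lambda>n. LINT x:box (- real n *\<^sub>R One) (real n *\<^sub>R One)|lebesgue. h x) \<longlonglongrightarrow>
        (LINT x:(\<Union>n. box (- real n *\<^sub>R One) (real n *\<^sub>R One))|lebesgue. h x)"
      by (intro set_integral_cont_up seth) (auto simp: incseq_def box_def)
    then show ?thesis
      by (simp add: box UN_box_eq_UNIV LIMSEQ_const_iff)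
  qed
  have borel0: "(LINT x:A|lebesgue. h x) = 0" if "A \<in> sets borel" for A
  proof -
    have "Int_stable (range (\<lambda>(a, b). box a b :: 'a set))"
      by (auto simp: Int_stable_def box_Int_box)
    moreover have "(range (\<lambda>(a, b). box a b :: 'a set)) \<subseteq> Pow UNIV" by auto
    moreover have "A \<in> sigma_sets UNIV (range (\<lambda>(a, b). box a b))"
      using that unfolding borel_eq_box by simp
    ultimately show ?thesis
    proof (induction rule: sigma_sets_induct_disjoint)
      case (basic A)
      then show ?case by (auto simp: box)
    next
      case empty
      show ?case by (simp add: set_lebesgue_integral_def)
    next
      case (compl A)
      then have A: "A \<in> sets lebesgue"
        by (simp add: borel_eq_box)
      have "(LINT x:A \<union> (UNIV - A)|lebesgue. h x) = (LINT x:A|lebesgue. h x) + (LINT x:UNIV - A|lebesgue. h x)"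
        using A by (intro set_integral_Un seth) auto
      then show ?case using compl UNIV0 by simp
    next
      case (union F)
      then have F: "F i \<in> sets lebesgue" for i
        by (simp add: borel_eq_box subset_eq)
      have "(LINT x:(\<Union>i. F i)|lebesgue. h x) = (\<Sum>i. (LINT x:(F i)|lebesgue. h x))"
        using F union(1) by (intro lebesgue_integral_countable_add seth) (auto simp: disjoint_family_on_def)
      then show ?case using union by simp
    qed
  qed
  \<comment> \<open>A Lebesgue set is a Borel set up to a subset of a null set, so the integral over
    it equals one over a Borel set.\<close>
  have leb0: "(LINT x:A|lebesgue. h x) = 0" if A: "A \<in> sets lebesgue" for A
  proof -
    from A obtain S N N' where S: "A = S \<union> N" "N \<subseteq> N'" "N' \<in> null_sets lborel" "S \<in> sets lborel"
      by (rule sets_completionE)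
    have "N' \<in> null_sets lebesgue" using S by (simp add: null_sets_completionI)
    then have "AE x in lebesgue. x \<in> A \<longleftrightarrow> x \<in> S"
      by (rule AE_I') (use S in auto)
    then have "(LINT x:A|lebesgue. h x) = (LINT x:S|lebesgue. h x)"
      using A S h unfolding set_lebesgue_integral_def
      by (intro integral_cong_AE borel_measurable_scaleR borel_measurable_indicator)
         (auto simp: indicator_def elim: eventually_mono)
    then show ?thesis using borel0 S by simp
  qed
  \<comment> \<open>The values 1 and -1 of \<open>c\<close> give the positive and the negative part
    of h. Each is a nonnegative function with integral 0.\<close>
  have part: "AE x in lebesgue. indicator {x. 0 < c * h x} x *\<^sub>R (c * h x) = 0" for c
  proof -
    have [measurable]: "h \<in> borel_measurable lebesgue" using h by auto
    have A: "{x. 0 < c * h x} \<in> sets lebesgue"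
      using borel_measurable_less[of "\<lambda>_. 0" lebesgue "\<lambda>x. c * h x"] by simp
    have "(LINT x|lebesgue. indicator {x. 0 < c * h x} x *\<^sub>R (c * h x)) = c * (LINT x:{x. 0 < c * h x}|lebesgue. h x)"
      by (simp add: set_lebesgue_integral_def mult.left_commute)
    also have "\<dots> = 0" using leb0[OF A] by simp
    finally have "(LINT x|lebesgue. indicator {x. 0 < c * h x} x *\<^sub>R (c * h x)) = 0" .
    moreover have "integrable lebesgue (\<lambda>x. indicator {x. 0 < c * h x} x *\<^sub>R (c * h x))"
      using h by (intro integrable_mult_indicator A) simp
    ultimately show ?thesis
      using integral_nonneg_eq_0_iff_AE[of lebesgue "\<lambda>x. indicator {x. 0 < c * h x} x *\<^sub>R (c * h x)"]
      by (auto simp: indicator_def)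
  qed
  show ?thesis
    using part[of 1] part[of "-1"] by eventually_elim (auto simp: indicator_def split: if_splits)
qed

section \<open>The domain as a finite measure space; continuous and smooth functions on it\<close>

lemma Omega_sets: "Omega \<in> sets lebesgue"
  by (simp add: Omega_def)

lemma finite_measure_Omega: "finite_measure (lebesgue_on (Omega :: (real^'n) set))"
  by (intro finite_measureI) (simp add: Omega_def emeasure_restrict_space emeasure_lborel_cbox_eq)

text \<open>The frontier of a convex set is negligible. Test functions see only the interior, and
  this extends their information to almost all of \<open>Omega\<close>.\<close>

lemma AE_Omega_interior: "AE x in lebesgue_on (Omega :: (real^'n) set). x \<in> interior Omega"
proof -
  have "frontier (Omega :: (real^'n) set) \<in> null_sets lebesgue"
    using negligible_convex_frontier[of "Omega :: (real^'n) set"]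
    by (simp add: Omega_def negligible_iff_null_sets)
  then have "AE x in lebesgue. x \<notin> frontier (Omega :: (real^'n) set)"
    by (rule AE_not_in)
  then show ?thesis
    unfolding AE_restrict_space_iff[of Omega lebesgue, simplified, OF Omega_sets]
    by eventually_elim (auto simp: frontier_def Omega_def)
qed

lemma continuous_on_Omega_measurable:
  "continuous_on Omega f \<Longrightarrow> f \<in> borel_measurable (lebesgue_on Omega)"
  by (rule continuous_imp_measurable_on_sets_lebesgue[OF _ Omega_sets])

lemma continuous_on_Omega_bounded:
  assumes "continuous_on (Omega :: (real^'n) set) (f :: _ \<Rightarrow> 'b::euclidean_space)"
  obtains B where "\<And>x. x \<in> Omega \<Longrightarrow> norm (f x) \<le> B"
proof -
  have "bounded (f ` Omega)"
    by (intro compact_imp_bounded compact_continuous_image assms) (simp add: Omega_def)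
  then show thesis using that by (auto simp: bounded_iff)
qed

lemma continuous_on_Omega_L2:
  assumes "continuous_on (Omega :: (real^'n) set) (f :: _ \<Rightarrow> 'b::euclidean_space)"
  shows "f \<in> L2 Omega"
proof -
  obtain B where B: "\<And>x. x \<in> Omega \<Longrightarrow> norm (f x) \<le> B"
    using continuous_on_Omega_bounded[OF assms] by blast
  have [measurable]: "f \<in> borel_measurable (lebesgue_on Omega)"
    by (rule continuous_on_Omega_measurable[OF assms])
  have "integrable (lebesgue_on Omega) (\<lambda>x. (norm (f x))\<^sup>2)"
    by (rule finite_measure.integrable_const_bound[OF finite_measure_Omega, where B="B\<^sup>2"])
       (auto intro!: AE_I2 power_mono B)
  then show ?thesis by (simp add: L2_def)
qed

lemma smooth_onD_differentiable:
  assumes "smooth_on UNIV f"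
  shows "partials \<sigma> f differentiable (at x)"
  using assms by (auto simp: smooth_on_def differentiable_on_def)

lemma smooth_on_partials_continuous:
  assumes "smooth_on UNIV f"
  shows "continuous_on S (partials \<sigma> f)"
  using smooth_onD_differentiable[OF assms]
  by (meson continuous_at_imp_continuous_on differentiable_imp_continuous_within)

lemma smooth_on_continuous:
  assumes "smooth_on UNIV f"
  shows "continuous_on S f"
  using smooth_on_partials_continuous[OF assms, of S "[]"] by simp

lemma smooth_on_partial_continuous:
  assumes "smooth_on UNIV f"
  shows "continuous_on S (partial i f)"
  using smooth_on_partials_continuous[OF assms, of S "[i]"] by simp

text \<open>The product ab of two nonnegative numbers is at most the sum of their squares, which is
  an integrable majorant here.\<close>

lemma L2_integrable_scaleR:
  fixes f :: "real^'n \<Rightarrow> 'b::euclidean_space"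
  assumes f: "f \<in> L2 S" and S: "S \<in> sets lebesgue" and r: "r \<in> L2 S"
  shows "integrable (lebesgue_on S) (\<lambda>x. r x *\<^sub>R f x)"
proof (rule Bochner_Integration.integrable_bound)
  show "integrable (lebesgue_on S) (\<lambda>x. (norm (r x))\<^sup>2 + (norm (f x))\<^sup>2)"
    using assms by (auto simp: L2_def)
  show "(\<lambda>x. r x *\<^sub>R f x) \<in> borel_measurable (lebesgue_on S)"
    using assms by (auto simp: L2_def)
  have "a * b \<le> a\<^sup>2 + b\<^sup>2" if "a \<ge> 0" "b \<ge> 0" for a b :: real
    using sum_squares_bound[of a b] that mult_nonneg_nonneg[OF that] by linarith
  from this[of "norm (r x)" "norm (f x)" for x]
  show "AE x in lebesgue_on S. norm (r x *\<^sub>R f x) \<le> norm ((norm (r x))\<^sup>2 + (norm (f x))\<^sup>2)"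
    by (intro AE_I2) simp
qed

lemma L2_integrable:
  fixes f :: "real^'n \<Rightarrow> 'b::euclidean_space"
  assumes "f \<in> L2 Omega"
  shows "integrable (lebesgue_on Omega) f"
  using L2_integrable_scaleR[OF assms Omega_sets, of "\<lambda>_. 1"] continuous_on_Omega_L2[of "\<lambda>_. 1::real"]
  by simp

text \<open>Testing with bumps and passing to the limit by dominated convergence shows that h has
  integral 0 over every open box in the interior. The criterion by box integrals then applies to the
  extension of h by zero.\<close>

lemma fundamental_lemma_real:
  fixes h :: "real^'n \<Rightarrow> real"
  assumes h: "integrable (lebesgue_on Omega) h"
    and test: "\<And>\<theta>. test_function \<theta> \<Longrightarrow> (LINT x|lebesgue_on Omega. \<theta> x * h x) = 0"
  shows "AE x in lebesgue_on Omega. h x = 0"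
proof -
  \<comment> \<open>Extension by zero, cut off at the interior so that integrals over arbitrary
    boxes reduce to boxes where bumps are test functions.\<close>
  let ?h = "\<lambda>x. indicator (interior Omega) x *\<^sub>R (indicator Omega x *\<^sub>R h x)"
  have [simp]: "Omega \<in> sets lebesgue" "interior Omega \<in> sets lebesgue" by (auto simp: Omega_def)
  have inth: "integrable lebesgue (\<lambda>x. indicator Omega x *\<^sub>R h x)"
    using h by (simp add: integrable_restrict_space)
  have small: "(LINT x|lebesgue_on Omega. indicator (box a b) x *\<^sub>R h x) = 0"
    if "box a b \<subseteq> interior Omega" for a b :: "real^'n"
  proof -
    have "(\<lambda>m. LINT x|lebesgue_on Omega. box_bump a b (Suc m) x *\<^sub>R h x)
       \<longlonglongrightarrow> (LINT x|lebesgue_on Omega. indicator (box a b) x *\<^sub>R h x)"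
    proof (rule integral_dominated_convergence[where w="\<lambda>x. norm (h x)"])
      show "integrable (lebesgue_on Omega) (\<lambda>x. norm (h x))" using h by simp
      have [measurable]: "h \<in> borel_measurable (lebesgue_on Omega)" using h by simp
      moreover have "indicator (box a b) \<in> borel_measurable (lebesgue_on Omega)"
        by (intro measurable_restrict_space1 borel_measurable_indicator) simp
      ultimately show "(\<lambda>x. indicator (box a b) x *\<^sub>R h x) \<in> borel_measurable (lebesgue_on Omega)"
        by (intro borel_measurable_scaleR)
      show "AE x in lebesgue_on Omega. (\<lambda>m. box_bump a b (Suc m) x *\<^sub>R h x)
             \<longlonglongrightarrow> indicator (box a b) x *\<^sub>R h x"
        by (intro AE_I2 tendsto_scaleR box_bump_tendsto tendsto_const)
      fix m
      have "continuous_on Omega (box_bump a b (Suc m))"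
        by (intro smooth_on_continuous smooth_on_flat_algebra box_bump_in_flat_algebra)
      then show "(\<lambda>x. box_bump a b (Suc m) x *\<^sub>R h x) \<in> borel_measurable (lebesgue_on Omega)"
        using continuous_on_Omega_measurable by measurable
      show "AE x in lebesgue_on Omega. norm (box_bump a b (Suc m) x *\<^sub>R h x) \<le> norm (h x)"
        using box_bump_bounds[of a b "Suc m"] by (intro AE_I2) (simp add: abs_mult mult_left_le_one_le)
    qed
    then show ?thesis
      by (simp add: test[OF test_function_box_bump[OF that]] LIMSEQ_const_iff)
  qed
  have "AE x in lebesgue. ?h x = 0"
  proof (rule AE_eq_0_if_box_integrals_eq_0)
    show "integrable lebesgue ?h"
      by (rule integrable_mult_indicator[OF _ inth]) simp
    fix a b :: "real^'n"
    \<comment> \<open>The interior of \<open>Omega\<close> is itself an open box, and two open boxes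
      meet in an open box.\<close>
    obtain c d :: "real^'n" where cd: "box a b \<inter> interior Omega = box c d"
      by (auto simp: interior_Omega box_Int_box)
    have "(LINT x:box a b|lebesgue. ?h x) = (LINT x|lebesgue. indicator Omega x *\<^sub>R (indicator (box c d) x *\<^sub>R h x))"
      unfolding set_lebesgue_integral_def cd[symmetric]
      by (intro Bochner_Integration.integral_cong) (auto simp: indicator_def)
    also have "\<dots> = (LINT x|lebesgue_on Omega. indicator (box c d) x *\<^sub>R h x)"
      by (simp add: integral_restrict_space)
    also have "\<dots> = 0" using cd by (intro small) auto
    finally show "(LINT x:box a b|lebesgue. ?h x) = 0" .
  qed
  then have "AE x in lebesgue_on Omega. ?h x = 0"
    by (subst AE_restrict_space_iff) (auto elim: eventually_mono)
  then show ?thesis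
    using AE_Omega_interior
    by eventually_elim (use interior_subset in \<open>auto simp: indicator_def split: if_splits\<close>)
qed

text \<open>Both gradients have the same integrals against test functions. The real fundamental
  lemma is applied to each component of the difference, with \<open>p\<close> being
  \<open>Re\<close> and then \<open>Im\<close>.\<close>

lemma weak_gradient_unique:
  fixes g g' :: "real^'n \<Rightarrow> complex^'n"
  assumes g: "g \<in> L2 Omega" "weak_gradient w g" and g': "g' \<in> L2 Omega" "weak_gradient w g'"
  shows "AE x in lebesgue_on Omega. g x = g' x"
proof -
  have *: "AE x in lebesgue_on Omega. p (g x $ i - g' x $ i) = 0"
    if p: "bounded_linear p" for i and p :: "complex \<Rightarrow> real"
  proof (rule fundamental_lemma_real)
    have ig: "integrable (lebesgue_on Omega) g" "integrable (lebesgue_on Omega) g'"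
      by (rule L2_integrable[OF g(1)], rule L2_integrable[OF g'(1)])
    have igi: "integrable (lebesgue_on Omega) (\<lambda>x. g x $ i - g' x $ i)"
      by (intro Bochner_Integration.integrable_diff
          integrable_bounded_linear[OF bounded_linear_vec_nth ig(1)]
          integrable_bounded_linear[OF bounded_linear_vec_nth ig(2)])
    then show "integrable (lebesgue_on Omega) (\<lambda>x. p (g x $ i - g' x $ i))"
      by (rule integrable_bounded_linear[OF p])
    fix \<theta> :: "real^'n \<Rightarrow> real" assume t: "test_function \<theta>"
    have tL: "\<theta> \<in> L2 Omega"
      using t by (auto simp: test_function_def intro: continuous_on_Omega_L2 smooth_on_continuous)
    have i1: "integrable (lebesgue_on Omega) (\<lambda>x. \<theta> x *\<^sub>R g x)" "integrable (lebesgue_on Omega) (\<lambda>x. \<theta> x *\<^sub>R g' x)"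
      using g g' tL by (auto intro: L2_integrable_scaleR[OF _ Omega_sets])
    have i2: "integrable (lebesgue_on Omega) (\<lambda>x. \<theta> x *\<^sub>R (g x $ i))" "integrable (lebesgue_on Omega) (\<lambda>x. \<theta> x *\<^sub>R (g' x $ i))"
      using i1[THEN integrable_bounded_linear[OF bounded_linear_vec_nth[of i]]] by simp_all
    have "(LINT x|lebesgue_on Omega. \<theta> x *\<^sub>R (g x $ i - g' x $ i)) = 0"
      using t g(2) g'(2) i2 by (simp add: weak_gradient_def scaleR_diff_right)
    then have "p (LINT x|lebesgue_on Omega. \<theta> x *\<^sub>R (g x $ i - g' x $ i)) = 0"
      using linear_0[OF bounded_linear.linear[OF p]] by simp
    then show "(LINT x|lebesgue_on Omega. \<theta> x * p (g x $ i - g' x $ i)) = 0"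
      using i2 integral_bounded_linear[OF p, of "lebesgue_on Omega" "\<lambda>x. \<theta> x *\<^sub>R (g x $ i - g' x $ i)"]
      by (simp add: scaleR_diff_right right_diff_distrib linear_cmul[OF bounded_linear.linear[OF p]] linear_diff[OF bounded_linear.linear[OF p]])
  qed
  have "AE x in lebesgue_on Omega. \<forall>i\<in>UNIV. Re (g x $ i - g' x $ i) = 0 \<and> Im (g x $ i - g' x $ i) = 0"
    by (intro AE_finite_allI AE_conjI * bounded_linear_Re bounded_linear_Im) simp
  then show ?thesis
    by eventually_elim (simp add: vec_eq_iff complex_eq_iff)
qed

lemma grad_H1:
  assumes "w \<in> H1"
  shows "grad w \<in> L2 Omega" "weak_gradient w (grad w)"
proof -
  have "\<exists>g. g \<in> L2 Omega \<and> weak_gradient w g" using assms by (auto simp: H1_def)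
  from someI_ex[OF this] show "grad w \<in> L2 Omega" "weak_gradient w (grad w)"
    by (auto simp: grad_def)
qed

text \<open>\<open>grad\<close> picks an arbitrary weak gradient, so it can be computed only up to
  null sets; the calculus rules for it below go through this lemma.\<close>

lemma grad_AE_eqI:
  assumes "w \<in> H1" "g \<in> L2 Omega" "weak_gradient w g"
  shows "AE x in lebesgue_on Omega. grad w x = g x"
  using weak_gradient_unique grad_H1 assms by blast

section \<open>The periodic Sobolev space\<close>

lemma norm_add_sq_le:
  fixes x y :: "'a::real_normed_vector"
  shows "(norm (x + y))\<^sup>2 \<le> 2 * (norm x)\<^sup>2 + 2 * (norm y)\<^sup>2"
proof -
  have "(norm (x + y))\<^sup>2 \<le> (norm x + norm y)\<^sup>2"
    by (intro power_mono norm_triangle_ineq) simp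
  also have "\<dots> \<le> 2 * (norm x)\<^sup>2 + 2 * (norm y)\<^sup>2"
    using sum_squares_bound[of "norm x" "norm y"] by (simp add: power2_sum)
  finally show ?thesis .
qed

lemma L2_add:
  fixes f g :: "real^'n \<Rightarrow> 'b::euclidean_space"
  assumes f: "f \<in> L2 S" and g: "g \<in> L2 S"
  shows "(\<lambda>x. f x + g x) \<in> L2 S"
proof -
  have [measurable]: "f \<in> borel_measurable (lebesgue_on S)" "g \<in> borel_measurable (lebesgue_on S)"
    using assms by (auto simp: L2_def)
  have "integrable (lebesgue_on S) (\<lambda>x. (norm (f x + g x))\<^sup>2)"
  proof (rule Bochner_Integration.integrable_bound)
    show "integrable (lebesgue_on S) (\<lambda>x. 2 * (norm (f x))\<^sup>2 + 2 * (norm (g x))\<^sup>2)"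
      using assms by (auto simp: L2_def)
    show "AE x in lebesgue_on S. norm ((norm (f x + g x))\<^sup>2) \<le> norm (2 * (norm (f x))\<^sup>2 + 2 * (norm (g x))\<^sup>2)"
      using norm_add_sq_le by (intro AE_I2) simp
  qed simp
  then show ?thesis by (simp add: L2_def)
qed

lemma L2_bounded_linear:
  assumes f: "f \<in> L2 S" and p: "bounded_linear p"
  shows "(\<lambda>x. p (f x)) \<in> L2 S"
proof -
  obtain K where K: "\<And>x. norm (p x) \<le> norm x * K"
    using bounded_linear.bounded[OF p] by blast
  have "p \<in> borel_measurable borel"
    by (intro borel_measurable_continuous_onI linear_continuous_on p)
  then have [measurable]: "(\<lambda>x. p (f x)) \<in> borel_measurable (lebesgue_on S)"
    using f by (auto simp: L2_def)
  have "integrable (lebesgue_on S) (\<lambda>x. (norm (p (f x)))\<^sup>2)"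
  proof (rule Bochner_Integration.integrable_bound)
    show "integrable (lebesgue_on S) (\<lambda>x. K\<^sup>2 * (norm (f x))\<^sup>2)"
      using f by (auto simp: L2_def)
    show "AE x in lebesgue_on S. norm ((norm (p (f x)))\<^sup>2) \<le> norm (K\<^sup>2 * (norm (f x))\<^sup>2)"
      using power_mono[OF K norm_ge_zero, of _ 2] by (intro AE_I2) (simp add: power_mult_distrib mult.commute)
  qed simp
  then show ?thesis by (simp add: L2_def)
qed

lemma L2norm_nonneg [simp]: "0 \<le> L2norm S f"
  by (simp add: L2norm_def)

lemma L2norm_sq: "(L2norm S f)\<^sup>2 = (LINT x|lebesgue_on S. (norm (f x))\<^sup>2)"
  by (simp add: L2norm_def)

lemma L2norm_bounded_linear_le:
  assumes p: "bounded_linear p"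
  shows "\<exists>K. \<forall>f \<in> L2 S. L2norm S (\<lambda>x. p (f x)) \<le> K * L2norm S f"
proof -
  obtain K where K: "K \<ge> 0" "\<And>x. norm (p x) \<le> norm x * K"
    using bounded_linear.nonneg_bounded[OF p] by blast
  have "L2norm S (\<lambda>x. p (f x)) \<le> K * L2norm S f" if f: "f \<in> L2 S" for f
  proof (rule power2_le_imp_le)
    have "(LINT x|lebesgue_on S. (norm (p (f x)))\<^sup>2) \<le> (LINT x|lebesgue_on S. K\<^sup>2 * (norm (f x))\<^sup>2)"
      using f L2_bounded_linear[OF f p] power_mono[OF K(2) norm_ge_zero, of _ 2]
      by (intro integral_mono) (auto simp: L2_def power_mult_distrib mult.commute)
    then show "(L2norm S (\<lambda>x. p (f x)))\<^sup>2 \<le> (K * L2norm S f)\<^sup>2"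
      by (simp add: power_mult_distrib L2norm_sq)
  qed (use K in auto)
  then show ?thesis by blast
qed

text \<open>The factor 2 is the price for using only the pointwise bound
  \<open>norm_add_sq_le\<close>. It is harmless, since the inequality serves to pass convergence to
  0 on to sums.\<close>

lemma L2norm_add_le:
  fixes f g :: "real^'n \<Rightarrow> 'b::euclidean_space"
  assumes f: "f \<in> L2 S" and g: "g \<in> L2 S"
  shows "L2norm S (\<lambda>x. f x + g x) \<le> 2 * (L2norm S f + L2norm S g)"
proof (rule power2_le_imp_le)
  have "(LINT x|lebesgue_on S. (norm (f x + g x))\<^sup>2) \<le> (LINT x|lebesgue_on S. 2 * (norm (f x))\<^sup>2 + 2 * (norm (g x))\<^sup>2)"
    using f g L2_add[OF f g] by (intro integral_mono norm_add_sq_le) (auto simp: L2_def)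
  also have "\<dots> = 2 * (L2norm S f)\<^sup>2 + 2 * (L2norm S g)\<^sup>2"
    using f g by (simp add: L2norm_sq L2_def)
  also have "\<dots> \<le> (2 * (L2norm S f + L2norm S g))\<^sup>2"
    by (simp add: power2_eq_square algebra_simps)
  finally show "(L2norm S (\<lambda>x. f x + g x))\<^sup>2 \<le> (2 * (L2norm S f + L2norm S g))\<^sup>2"
    by (simp add: L2norm_sq)
qed simp

lemma L2norm_cong_AE:
  assumes "f \<in> borel_measurable (lebesgue_on S)" "g \<in> borel_measurable (lebesgue_on S)"
    and "AE x in lebesgue_on S. f x = g x"
  shows "L2norm S f = L2norm S g"
  unfolding L2norm_def
  by (rule arg_cong[where f=sqrt], rule integral_cong_AE) (use assms in auto)

lemma L2_diff:
  fixes f g :: "real^'n \<Rightarrow> 'b::euclidean_space"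
  assumes f: "f \<in> L2 S" and g: "g \<in> L2 S"
  shows "(\<lambda>x. f x - g x) \<in> L2 S"
  using L2_add[OF f L2_bounded_linear[OF g bounded_linear_minus[OF bounded_linear_ident]]] by simp

lemma L2_measurable: "f \<in> L2 S \<Longrightarrow> f \<in> borel_measurable (lebesgue_on S)"
  by (simp add: L2_def)

lemma L2norm_tendsto_0_add:
  fixes f g :: "nat \<Rightarrow> real^'n \<Rightarrow> 'b::euclidean_space"
  assumes "\<And>n. f n \<in> L2 S" "\<And>n. g n \<in> L2 S"
    and "(\<lambda>n. L2norm S (f n)) \<longlonglongrightarrow> 0" "(\<lambda>n. L2norm S (g n)) \<longlonglongrightarrow> 0"
  shows "(\<lambda>n. L2norm S (\<lambda>x. f n x + g n x)) \<longlonglongrightarrow> 0"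
proof (rule tendsto_sandwich[OF _ _ tendsto_const])
  have "(\<lambda>n. 2 * (L2norm S (f n) + L2norm S (g n))) \<longlonglongrightarrow> 2 * (0 + 0)"
    by (intro tendsto_intros assms)
  then show "(\<lambda>n. 2 * (L2norm S (f n) + L2norm S (g n))) \<longlonglongrightarrow> 0" by simp
  show "\<forall>\<^sub>F n in sequentially. L2norm S (\<lambda>x. f n x + g n x) \<le> 2 * (L2norm S (f n) + L2norm S (g n))"
    by (intro always_eventually allI L2norm_add_le assms)
qed simp

lemma L2norm_tendsto_0_bounded_linear:
  assumes f: "\<And>n. f n \<in> L2 S" and p: "bounded_linear p"
    and "(\<lambda>n. L2norm S (f n)) \<longlonglongrightarrow> 0"
  shows "(\<lambda>n. L2norm S (\<lambda>x. p (f n x))) \<longlonglongrightarrow> 0"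
proof -
  obtain K where K: "\<And>f. f \<in> L2 S \<Longrightarrow> L2norm S (\<lambda>x. p (f x)) \<le> K * L2norm S f"
    using L2norm_bounded_linear_le[OF p] by blast
  show ?thesis
  proof (rule tendsto_sandwich[OF _ _ tendsto_const])
    have "(\<lambda>n. K * L2norm S (f n)) \<longlonglongrightarrow> K * 0"
      by (intro tendsto_intros assms)
    then show "(\<lambda>n. K * L2norm S (f n)) \<longlonglongrightarrow> 0" by simp
  qed (use f K in \<open>auto intro!: always_eventually\<close>)
qed

section \<open>Linearity of classical derivatives\<close>

lemma partials_add:
  fixes f g :: "real^'n \<Rightarrow> 'b::real_normed_vector"
  assumes "smooth_on UNIV f" "smooth_on UNIV g"
  shows "partials \<sigma> (\<lambda>x. f x + g x) = (\<lambda>x. partials \<sigma> f x + partials \<sigma> g x)"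
proof (induction \<sigma>)
  case (Cons i \<sigma>)
  have "((\<lambda>x. partials \<sigma> f x + partials \<sigma> g x) has_derivative
      (\<lambda>h. frechet_derivative (partials \<sigma> f) (at x) h + frechet_derivative (partials \<sigma> g) (at x) h)) (at x)" for x
    using smooth_onD_differentiable[OF assms(1), of \<sigma> x] smooth_onD_differentiable[OF assms(2), of \<sigma> x]
    by (intro has_derivative_add) (simp_all add: frechet_derivative_works[symmetric])
  from partial_eqI[OF this, of i] show ?case
    using Cons by (simp add: partial_def)
qed simp

lemma partials_bounded_linear:
  assumes f: "smooth_on UNIV f" and p: "bounded_linear p"
  shows "partials \<sigma> (\<lambda>x. p (f x)) = (\<lambda>x. p (partials \<sigma> f x))"
proof (induction \<sigma>)
  case (Cons i \<sigma>)
  have "((\<lambda>x. p (partials \<sigma> f x)) has_derivative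
      (\<lambda>h. p (frechet_derivative (partials \<sigma> f) (at x) h))) (at x)" for x
    using smooth_onD_differentiable[OF f, of \<sigma> x]
    by (intro bounded_linear.has_derivative[OF p]) (simp add: frechet_derivative_works[symmetric])
  from partial_eqI[OF this, of i] show ?case
    using Cons by (simp add: partial_def)
qed simp

lemma smooth_on_add:
  assumes "smooth_on UNIV f" "smooth_on UNIV g"
  shows "smooth_on UNIV (\<lambda>x. f x + g x)"
  using assms partials_add[OF assms] by (auto simp: smooth_on_def)

lemma smooth_on_bounded_linear:
  assumes "smooth_on UNIV f" "bounded_linear p"
  shows "smooth_on UNIV (\<lambda>x. p (f x))"
  unfolding smooth_on_def partials_bounded_linear[OF assms] differentiable_on_def
  using smooth_onD_differentiable[OF assms(1)] bounded_linear.has_derivative[OF assms(2)]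
  unfolding differentiable_def by blast

text \<open>Complex scalars act on \<open>complex^'n\<close> by \<open>*s\<close>, whereas the
  normed space structure has only real scalars. As a real-linear map in finite dimension the action
  is bounded.\<close>

lemma bounded_linear_smult: "bounded_linear (\<lambda>v :: complex^'n. c *s v)"
  by (intro linear_conv_bounded_linear[THEN iffD1] linearI) (simp_all add: vec_eq_iff algebra_simps)

section \<open>Linearity of weak gradients\<close>

lemma test_function_L2:
  assumes "test_function \<theta>"
  shows "\<theta> \<in> L2 Omega" "partial i \<theta> \<in> L2 Omega"
  using assms by (auto simp: test_function_def intro: continuous_on_Omega_L2 smooth_on_continuous
      smooth_on_partial_continuous)

lemma L2_component: "g \<in> L2 S \<Longrightarrow> (\<lambda>x. g x $ i) \<in> L2 S" for g :: "real^'n \<Rightarrow> complex^'n"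
  by (rule L2_bounded_linear[OF _ bounded_linear_vec_nth])

lemma weak_gradient_add:
  fixes w w' :: "real^'n \<Rightarrow> complex"
  assumes "w \<in> L2 Omega" "g \<in> L2 Omega" "weak_gradient w g"
    and "w' \<in> L2 Omega" "g' \<in> L2 Omega" "weak_gradient w' g'"
  shows "weak_gradient (\<lambda>x. w x + w' x) (\<lambda>x. g x + g' x)"
  unfolding weak_gradient_def
proof (intro allI impI)
  fix \<theta> :: "real^'n \<Rightarrow> real" and i assume t: "test_function \<theta>"
  have i1: "integrable (lebesgue_on Omega) (\<lambda>x. partial i \<theta> x *\<^sub>R w x)"
    "integrable (lebesgue_on Omega) (\<lambda>x. partial i \<theta> x *\<^sub>R w' x)"
    by (intro L2_integrable_scaleR Omega_sets assms test_function_L2 t)+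
  have i2: "integrable (lebesgue_on Omega) (\<lambda>x. \<theta> x *\<^sub>R (g x $ i))"
    "integrable (lebesgue_on Omega) (\<lambda>x. \<theta> x *\<^sub>R (g' x $ i))"
    by (intro L2_integrable_scaleR Omega_sets L2_component assms test_function_L2 t)+
  have "(LINT x|lebesgue_on Omega. partial i \<theta> x *\<^sub>R (w x + w' x)) =
      (LINT x|lebesgue_on Omega. partial i \<theta> x *\<^sub>R w x) + (LINT x|lebesgue_on Omega. partial i \<theta> x *\<^sub>R w' x)"
    unfolding scaleR_add_right by (rule Bochner_Integration.integral_add[OF i1])
  moreover have "(LINT x|lebesgue_on Omega. \<theta> x *\<^sub>R ((g x + g' x) $ i)) =
      (LINT x|lebesgue_on Omega. \<theta> x *\<^sub>R (g x $ i)) + (LINT x|lebesgue_on Omega. \<theta> x *\<^sub>R (g' x $ i))"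
    unfolding scaleR_add_right vector_add_component by (rule Bochner_Integration.integral_add[OF i2])
  ultimately show "(LINT x|lebesgue_on Omega. partial i \<theta> x *\<^sub>R (w x + w' x)) =
      - (LINT x|lebesgue_on Omega. \<theta> x *\<^sub>R ((g x + g' x) $ i))"
    using assms(3,6) t by (simp add: weak_gradient_def)
qed

lemma weak_gradient_cmult:
  assumes "weak_gradient w g"
  shows "weak_gradient (\<lambda>x. c * w x) (\<lambda>x. c *s g x)"
  using assms by (auto simp: weak_gradient_def mult_scaleR_right[symmetric] simp del: mult_scaleR_right)

lemma H1_L2: "w \<in> H1 \<Longrightarrow> w \<in> L2 Omega"
  by (simp add: H1_def)

lemma H1_add:
  assumes "w \<in> H1" "w' \<in> H1"
  shows "(\<lambda>x. w x + w' x) \<in> H1"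
  unfolding H1_def using weak_gradient_add[OF H1_L2[OF assms(1)] grad_H1[OF assms(1)] H1_L2[OF assms(2)] grad_H1[OF assms(2)]]
    L2_add[OF grad_H1(1)[OF assms(1)] grad_H1(1)[OF assms(2)]] L2_add[OF H1_L2[OF assms(1)] H1_L2[OF assms(2)]]
  by auto

lemma H1_cmult:
  assumes "w \<in> H1"
  shows "(\<lambda>x. c * w x) \<in> H1"
  unfolding H1_def using weak_gradient_cmult[OF grad_H1(2)[OF assms], of c]
    L2_bounded_linear[OF grad_H1(1)[OF assms] bounded_linear_smult, of c]
    L2_bounded_linear[OF H1_L2[OF assms] bounded_linear_mult_right, of c]
  by auto

lemma grad_add:
  assumes "w \<in> H1" "w' \<in> H1"
  shows "AE x in lebesgue_on Omega. grad (\<lambda>x. w x + w' x) x = grad w x + grad w' x"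
  by (intro grad_AE_eqI H1_add weak_gradient_add L2_add H1_L2 grad_H1 assms)

lemma grad_cmult:
  assumes "w \<in> H1"
  shows "AE x in lebesgue_on Omega. grad (\<lambda>x. c * w x) x = c *s grad w x"
  by (intro grad_AE_eqI H1_cmult weak_gradient_cmult L2_bounded_linear[OF _ bounded_linear_smult] grad_H1 assms)

section \<open>Linearity of traces\<close>

lemma partial_add:
  assumes "smooth_on UNIV f" "smooth_on UNIV g"
  shows "partial j (\<lambda>x. f x + g x) x = partial j f x + partial j g x"
  using partials_add[OF assms, of "[j]"] by (simp add: fun_eq_iff)

lemma partial_bounded_linear:
  assumes "smooth_on UNIV f" "bounded_linear p"
  shows "partial j (\<lambda>x. p (f x)) x = p (partial j f x)"
  using partials_bounded_linear[OF assms, of "[j]"] by (simp add: fun_eq_iff)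

lemma L2_smooth: "smooth_on UNIV s \<Longrightarrow> s \<in> L2 Omega" for s :: "real^'n \<Rightarrow> complex"
  by (intro continuous_on_Omega_L2 smooth_on_continuous)

lemma L2_smooth_gradient:
  fixes s :: "real^'n \<Rightarrow> complex"
  assumes "smooth_on UNIV s"
  shows "(\<lambda>x. \<chi> j. partial j s x) \<in> L2 Omega"
  by (intro continuous_on_Omega_L2 continuous_on_vec_lambda smooth_on_partial_continuous[OF assms])

lemma L2_smooth_to_face:
  fixes s :: "real^'n \<Rightarrow> complex"
  assumes "smooth_on UNIV s"
  shows "(\<lambda>x. s (to_face i c x)) \<in> L2 Omega"
proof (intro continuous_on_Omega_L2 continuous_on_compose2[OF smooth_on_continuous[OF assms]])
  show "continuous_on Omega (to_face i c)"
    unfolding to_face_def[abs_def]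
  proof (rule continuous_on_vec_lambda)
    show "continuous_on Omega (\<lambda>x. if j = i then c else x $ j)" for j
      by (cases "j = i") (auto intro!: continuous_intros)
  qed
qed auto

text \<open>The sums of the two approximating sequences approximate the sum in all three norms that
  occur in \<open>has_trace\<close>.\<close>

lemma has_trace_add:
  fixes w w' :: "real^'n \<Rightarrow> complex"
  assumes w: "w \<in> H1" and w': "w' \<in> H1"
    and "has_trace w i c \<tau>" "has_trace w' i c \<tau>'"
  shows "has_trace (\<lambda>x. w x + w' x) i c (\<lambda>x. \<tau> x + \<tau>' x)"
proof -
  from assms(3) obtain s where s: "\<tau> \<in> L2 Omega" "\<And>n. smooth_on UNIV (s n)"
      "(\<lambda>n. L2norm Omega (\<lambda>x. s n x - w x)) \<longlonglongrightarrow> 0"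
      "(\<lambda>n. L2norm Omega (\<lambda>x. (\<chi> j. partial j (s n) x) - grad w x)) \<longlonglongrightarrow> 0"
      "(\<lambda>n. L2norm Omega (\<lambda>x. s n (to_face i c x) - \<tau> x)) \<longlonglongrightarrow> 0"
    by (auto simp: has_trace_def)
  from assms(4) obtain s' where s': "\<tau>' \<in> L2 Omega" "\<And>n. smooth_on UNIV (s' n)"
      "(\<lambda>n. L2norm Omega (\<lambda>x. s' n x - w' x)) \<longlonglongrightarrow> 0"
      "(\<lambda>n. L2norm Omega (\<lambda>x. (\<chi> j. partial j (s' n) x) - grad w' x)) \<longlonglongrightarrow> 0"
      "(\<lambda>n. L2norm Omega (\<lambda>x. s' n (to_face i c x) - \<tau>' x)) \<longlonglongrightarrow> 0"
    by (auto simp: has_trace_def)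
  note L2s = L2_diff L2_add L2_smooth L2_smooth_gradient L2_smooth_to_face s(1,2) s'(1,2)
    H1_L2[OF w] H1_L2[OF w'] grad_H1(1)[OF w] grad_H1(1)[OF w'] H1_add[OF w w', THEN grad_H1(1)]
  have smooth: "smooth_on UNIV (\<lambda>x. s n x + s' n x)" for n
    by (intro smooth_on_add s s')
  have "(\<lambda>n. L2norm Omega (\<lambda>x. (s n x - w x) + (s' n x - w' x))) \<longlonglongrightarrow> 0"
    by (intro L2norm_tendsto_0_add s s' L2s)
  moreover have "(\<lambda>n. L2norm Omega (\<lambda>x. (s n (to_face i c x) - \<tau> x) + (s' n (to_face i c x) - \<tau>' x))) \<longlonglongrightarrow> 0"
    by (intro L2norm_tendsto_0_add s s' L2s)
  moreover have "(\<lambda>n. L2norm Omega (\<lambda>x. ((\<chi> j. partial j (s n) x) - grad w x) + ((\<chi> j. partial j (s' n) x) - grad w' x))) \<longlonglongrightarrow> 0"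
    by (intro L2norm_tendsto_0_add s s' L2s)
  \<comment> \<open>The chosen gradient of the sum agrees with the sum of the chosen gradients only
    almost everywhere, which is enough for equality of norms.\<close>
  moreover have "L2norm Omega (\<lambda>x. ((\<chi> j. partial j (s n) x) - grad w x) + ((\<chi> j. partial j (s' n) x) - grad w' x))
     = L2norm Omega (\<lambda>x. (\<chi> j. partial j (\<lambda>x. s n x + s' n x) x) - grad (\<lambda>x. w x + w' x) x)" for n
  proof (rule L2norm_cong_AE)
    show "AE x in lebesgue_on Omega. ((\<chi> j. partial j (s n) x) - grad w x) + ((\<chi> j. partial j (s' n) x) - grad w' x) =
        (\<chi> j. partial j (\<lambda>x. s n x + s' n x) x) - grad (\<lambda>x. w x + w' x) x"
      using grad_add[OF w w']
      by eventually_elim (simp add: partial_add[OF s(2) s'(2)] vec_eq_iff add_diff_add)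
  qed (intro L2_measurable L2s smooth)+
  ultimately show ?thesis
    unfolding has_trace_def
    by (intro conjI exI[of _ "\<lambda>n x. s n x + s' n x"] allI smooth L2_add s s') (simp_all add: algebra_simps)
qed

lemma has_trace_cmult:
  fixes w :: "real^'n \<Rightarrow> complex"
  assumes w: "w \<in> H1" and "has_trace w i c \<tau>"
  shows "has_trace (\<lambda>x. a * w x) i c (\<lambda>x. a * \<tau> x)"
proof -
  from assms(2) obtain s where s: "\<tau> \<in> L2 Omega" "\<And>n. smooth_on UNIV (s n)"
      "(\<lambda>n. L2norm Omega (\<lambda>x. s n x - w x)) \<longlonglongrightarrow> 0"
      "(\<lambda>n. L2norm Omega (\<lambda>x. (\<chi> j. partial j (s n) x) - grad w x)) \<longlonglongrightarrow> 0"
      "(\<lambda>n. L2norm Omega (\<lambda>x. s n (to_face i c x) - \<tau> x)) \<longlonglongrightarrow> 0"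
    by (auto simp: has_trace_def)
  note bl = bounded_linear_mult_right[of a]
  note L2s = L2_diff L2_smooth L2_smooth_gradient L2_smooth_to_face s(1,2)
    H1_L2[OF w] grad_H1(1)[OF w] H1_cmult[OF w, THEN grad_H1(1)]
  have smooth: "smooth_on UNIV (\<lambda>x. a * s n x)" for n
    by (intro smooth_on_bounded_linear[OF _ bl] s)
  have "(\<lambda>n. L2norm Omega (\<lambda>x. a * (s n x - w x))) \<longlonglongrightarrow> 0"
    by (intro L2norm_tendsto_0_bounded_linear[OF _ bl] s L2s)
  moreover have "(\<lambda>n. L2norm Omega (\<lambda>x. a * (s n (to_face i c x) - \<tau> x))) \<longlonglongrightarrow> 0"
    by (intro L2norm_tendsto_0_bounded_linear[OF _ bl] s L2s)
  moreover have "(\<lambda>n. L2norm Omega (\<lambda>x. a *s ((\<chi> j. partial j (s n) x) - grad w x))) \<longlonglongrightarrow> 0"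
    by (intro L2norm_tendsto_0_bounded_linear[OF _ bounded_linear_smult] s L2s)
  moreover have "L2norm Omega (\<lambda>x. a *s ((\<chi> j. partial j (s n) x) - grad w x))
     = L2norm Omega (\<lambda>x. (\<chi> j. partial j (\<lambda>x. a * s n x) x) - grad (\<lambda>x. a * w x) x)" for n
  proof (rule L2norm_cong_AE)
    show "AE x in lebesgue_on Omega. a *s ((\<chi> j. partial j (s n) x) - grad w x) =
        (\<chi> j. partial j (\<lambda>x. a * s n x) x) - grad (\<lambda>x. a * w x) x"
      using grad_cmult[OF w, of a]
      by eventually_elim (simp add: partial_bounded_linear[OF s(2) bl] vec_eq_iff algebra_simps)
  qed (intro L2_measurable L2s smooth L2_bounded_linear[OF _ bounded_linear_smult])+
  ultimately show ?thesis
    unfolding has_trace_def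
    by (intro conjI exI[of _ "\<lambda>n x. a * s n x"] allI smooth L2_bounded_linear[OF _ bl] s) (simp_all add: algebra_simps)
qed

lemma H1P_H1: "w \<in> H1P \<Longrightarrow> w \<in> H1"
  by (simp add: H1P_def)

lemma H1P_L2: "w \<in> H1P \<Longrightarrow> w \<in> L2 Omega"
  by (intro H1_L2 H1P_H1)

lemma H1P_add: "w \<in> H1P \<Longrightarrow> w' \<in> H1P \<Longrightarrow> (\<lambda>x. w x + w' x) \<in> H1P"
  unfolding H1P_def using has_trace_add H1_add by blast

lemma H1P_cmult: "w \<in> H1P \<Longrightarrow> (\<lambda>x. a * w x) \<in> H1P"
  unfolding H1P_def using has_trace_cmult H1_cmult by blast

lemma H1P_diff: "w \<in> H1P \<Longrightarrow> w' \<in> H1P \<Longrightarrow> (\<lambda>x. w x - w' x) \<in> H1P"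
  using H1P_add[OF _ H1P_cmult[of w' "-1"]] by simp

section \<open>Inner products and the energy form\<close>

lemma L2inner_integrable:
  assumes "f \<in> L2 S" "g \<in> L2 S"
  shows "integrable (lebesgue_on S) (\<lambda>x. f x * cnj (g x))"
proof (rule Bochner_Integration.integrable_bound)
  have [measurable]: "f \<in> borel_measurable (lebesgue_on S)" "g \<in> borel_measurable (lebesgue_on S)"
    using assms by (auto simp: L2_def)
  have [measurable]: "(\<lambda>x. cnj (g x)) \<in> borel_measurable (lebesgue_on S)"
    by (rule L2_measurable[OF L2_bounded_linear[OF assms(2) bounded_linear_cnj]])
  show "(\<lambda>x. f x * cnj (g x)) \<in> borel_measurable (lebesgue_on S)" by measurable
  show "integrable (lebesgue_on S) (\<lambda>x. (norm (f x))\<^sup>2 + (norm (g x))\<^sup>2)"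
    using assms by (auto simp: L2_def)
  have "a * b \<le> a\<^sup>2 + b\<^sup>2" if "a \<ge> 0" "b \<ge> 0" for a b :: real
    using sum_squares_bound[of a b] that mult_nonneg_nonneg[OF that] by linarith
  from this[of "norm (f x)" "norm (g x)" for x]
  show "AE x in lebesgue_on S. norm (f x * cnj (g x)) \<le> norm ((norm (f x))\<^sup>2 + (norm (g x))\<^sup>2)"
    by (intro AE_I2) (simp add: norm_mult)
qed

lemma L2inner_add_left:
  assumes "f \<in> L2 Omega" "f' \<in> L2 Omega" "g \<in> L2 Omega"
  shows "L2inner (\<lambda>x. f x + f' x) g = L2inner f g + L2inner f' g"
  using L2inner_integrable[OF assms(1,3)] L2inner_integrable[OF assms(2,3)]
  by (simp add: L2inner_def distrib_right)

lemma L2inner_cmult_left: "L2inner (\<lambda>x. c * f x) g = c * L2inner f g"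
  by (simp add: L2inner_def mult.assoc)

lemma L2inner_commute: "L2inner f g = cnj (L2inner g f)"
  by (simp add: L2inner_def Bochner_Integration.integral_cnj[symmetric] mult.commute del: Bochner_Integration.integral_cnj)

lemma L2inner_diff_left:
  assumes "f \<in> L2 Omega" "f' \<in> L2 Omega" "g \<in> L2 Omega"
  shows "L2inner (\<lambda>x. f x - f' x) g = L2inner f g - L2inner f' g"
  using L2inner_integrable[OF assms(1,3)] L2inner_integrable[OF assms(2,3)]
  by (simp add: L2inner_def left_diff_distrib)

text \<open>The inequality is taken from nonnegative extended integrals of the pointwise norms.
  Integrability identifies these with the Lebesgue integrals.\<close>

lemma L2inner_Cauchy_Schwarz:
  assumes f: "f \<in> L2 Omega" and g: "g \<in> L2 Omega"
  shows "norm (L2inner f g) \<le> L2norm Omega f * L2norm Omega g"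
proof -
  let ?M = "lebesgue_on Omega"
  have [measurable]: "f \<in> borel_measurable ?M" "g \<in> borel_measurable ?M"
    using assms by (auto simp: L2_def)
  have ifg: "integrable ?M (\<lambda>x. norm (f x) * norm (g x))"
    using L2inner_integrable[OF f g, THEN integrable_norm] by (simp add: norm_mult)
  have sq: "(\<integral>\<^sup>+x. (ennreal (norm (h x)))\<^sup>2 \<partial>?M) = ennreal ((L2norm Omega h)\<^sup>2)"
    if "h \<in> L2 Omega" for h :: "real^'a \<Rightarrow> complex"
    using that by (simp add: ennreal_power nn_integral_eq_integral L2_def L2norm_sq)
  have "ennreal ((LINT x|?M. norm (f x) * norm (g x))\<^sup>2) = (\<integral>\<^sup>+x. ennreal (norm (f x)) * ennreal (norm (g x)) \<partial>?M)\<^sup>2"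
    using nn_integral_eq_integral[OF ifg]
    by (simp add: ennreal_mult[symmetric] ennreal_power[symmetric])
  also have "\<dots> \<le> ennreal ((L2norm Omega f)\<^sup>2) * ennreal ((L2norm Omega g)\<^sup>2)"
    unfolding sq[OF f, symmetric] sq[OF g, symmetric]
    by (rule Cauchy_Schwarz_nn_integral) auto
  also have "\<dots> = ennreal ((L2norm Omega f * L2norm Omega g)\<^sup>2)"
    by (simp add: ennreal_mult[symmetric] power_mult_distrib)
  finally have "(LINT x|?M. norm (f x) * norm (g x))\<^sup>2 \<le> (L2norm Omega f * L2norm Omega g)\<^sup>2"
    by simp
  then have "(LINT x|?M. norm (f x) * norm (g x)) \<le> L2norm Omega f * L2norm Omega g"
    by (rule power2_le_imp_le) simp
  moreover have "norm (L2inner f g) \<le> (LINT x|?M. norm (f x) * norm (g x))"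
    unfolding L2inner_def using integral_norm_bound[of ?M "\<lambda>x. f x * cnj (g x)"] by (simp add: norm_mult)
  ultimately show ?thesis by linarith
qed

lemma partials_0: "partials \<sigma> (\<lambda>_. 0) = (\<lambda>_. 0)"
proof (induction \<sigma>)
  case (Cons i \<sigma>)
  then show ?case
    using partial_eqI[where f="\<lambda>_. 0" and f'="\<lambda>_ _. 0" and i=i] by simp
qed simp

text \<open>Base case for finite sums. The constant sequence of zero functions witnesses all traces,
  once uniqueness has shown that the chosen gradient of 0 vanishes almost everywhere.\<close>

lemma H1P_0: "(\<lambda>_. 0) \<in> (H1P :: (real^'n \<Rightarrow> complex) set)"
proof -
  let ?z = "(\<lambda>_. 0) :: real^'n \<Rightarrow> complex" and ?g = "(\<lambda>_. 0) :: real^'n \<Rightarrow> complex^'n"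
  have p0: "partial j ?z = ?z" for j
    using partials_0[of "[j]"] by simp
  have smooth: "smooth_on UNIV ?z"
    unfolding smooth_on_def partials_0 by simp
  have z: "?z \<in> L2 Omega" "?g \<in> L2 Omega"
    by (auto intro!: continuous_on_Omega_L2)
  have wg: "weak_gradient ?z ?g" by (simp add: weak_gradient_def)
  then have H: "?z \<in> H1" using z by (auto simp: H1_def)
  have "L2norm Omega (\<lambda>x. (\<chi> j. partial j ?z x) - grad ?z x) = L2norm Omega ?g"
  proof (rule L2norm_cong_AE)
    show "AE x in lebesgue_on Omega. (\<chi> j. partial j ?z x) - grad ?z x = 0"
      using grad_AE_eqI[OF H z(2) wg]
      by eventually_elim (simp add: vec_eq_iff p0)
    have "(\<lambda>x. \<chi> j. partial j ?z x) = ?g"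
      by (simp add: vec_eq_iff fun_eq_iff p0)
    then show "(\<lambda>x. (\<chi> j. partial j ?z x) - grad ?z x) \<in> borel_measurable (lebesgue_on Omega)"
      using L2_measurable[OF L2_diff[OF z(2) grad_H1(1)[OF H]]] by (simp add: fun_eq_iff)
  qed (use z L2_measurable in auto)
  then have "has_trace ?z i c ?z" for i c
    unfolding has_trace_def using z smooth
    by (auto intro!: exI[of _ "\<lambda>_. ?z"] simp: L2norm_def)
  then show ?thesis using H unfolding H1P_def by blast
qed

lemma H1P_sum:
  assumes "finite I" "\<And>i. i \<in> I \<Longrightarrow> f i \<in> H1P"
  shows "(\<lambda>x. \<Sum>i\<in>I. f i x) \<in> H1P"
  using assms by (induction I rule: finite_induct) (auto intro: H1P_0 H1P_add)

section \<open>The inner product of gradients\<close>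

lemma L2inner_vec_eq_sum:
  fixes v w :: "real^'n \<Rightarrow> complex^'n"
  assumes "v \<in> L2 Omega" "w \<in> L2 Omega"
  shows "L2inner_vec v w = (\<Sum>i\<in>UNIV. L2inner (\<lambda>x. v x $ i) (\<lambda>x. w x $ i))"
  unfolding L2inner_vec_def L2inner_def
  by (intro Bochner_Integration.integral_sum L2inner_integrable L2_component assms)

lemma L2inner_vec_add_left:
  fixes v w v' :: "real^'n \<Rightarrow> complex^'n"
  assumes "v \<in> L2 Omega" "v' \<in> L2 Omega" "w \<in> L2 Omega"
  shows "L2inner_vec (\<lambda>x. v x + v' x) w = L2inner_vec v w + L2inner_vec v' w"
  using assms by (simp add: L2inner_vec_eq_sum L2_add L2inner_add_left L2_component sum.distrib)

lemma L2inner_vec_cmult_left: "L2inner_vec (\<lambda>x. c *s v x) w = c * L2inner_vec v w"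
  by (simp add: L2inner_vec_def mult.assoc sum_distrib_left[symmetric])

lemma L2inner_vec_commute: "L2inner_vec v w = cnj (L2inner_vec w v)"
  by (simp add: L2inner_vec_def Bochner_Integration.integral_cnj[symmetric] mult.commute
      del: Bochner_Integration.integral_cnj)

lemma L2inner_vec_self:
  fixes v :: "real^'n \<Rightarrow> complex^'n"
  shows "L2inner_vec v v = of_real ((L2norm Omega v)\<^sup>2)"
proof -
  have "(\<Sum>i\<in>UNIV. z $ i * cnj (z $ i)) = of_real ((norm z)\<^sup>2)" for z :: "complex^'n"
    by (simp add: norm_vec_def L2_set_def sum_nonneg complex_norm_square[symmetric] del: of_real_power)
  then show ?thesis
    unfolding L2inner_vec_def L2norm_sq by (simp only: integral_complex_of_real)
qed

text \<open>Lets the almost-everywhere rules \<open>grad_add\<close> and \<open>grad_cmult\<close>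
  be used inside the energy form. The left argument suffices, because Hermitian symmetry covers the
  right one.\<close>

lemma L2inner_vec_cong_AE:
  fixes v v' w :: "real^'n \<Rightarrow> complex^'n"
  assumes "v \<in> L2 Omega" "v' \<in> L2 Omega" "w \<in> L2 Omega"
    and "AE x in lebesgue_on Omega. v x = v' x"
  shows "L2inner_vec v w = L2inner_vec v' w"
proof -
  have "(\<lambda>x. \<Sum>i\<in>UNIV. u x $ i * cnj (w x $ i)) \<in> borel_measurable (lebesgue_on Omega)"
    if "u \<in> L2 Omega" for u :: "real^'n \<Rightarrow> complex^'n"
    by (intro borel_measurable_sum borel_measurable_integrable L2inner_integrable L2_component that assms)
  then show ?thesis
    unfolding L2inner_vec_def using assms by (intro integral_cong_AE) (auto elim: eventually_mono)
qed

text \<open>Collects the facts about the potential on which boundedness and coercivity of the form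
  rest. \<open>potential_elliptic_form\<close> derives them from \<open>potential\<close>.\<close>

locale elliptic_form =
  fixes \<epsilon> Vmin Vmax :: real and V :: "real^'n \<Rightarrow> real"
  assumes eps: "0 < \<epsilon>" and Vmin: "0 < Vmin"
    and V_bounds: "\<And>x. x \<in> Omega \<Longrightarrow> Vmin \<le> V x \<and> V x \<le> Vmax"
    and V_measurable: "V \<in> borel_measurable (lebesgue_on Omega)"
begin

lemma mult_V_L2:
  fixes v :: "real^'n \<Rightarrow> complex"
  assumes "v \<in> L2 Omega"
  shows "(\<lambda>x. of_real (V x) * v x) \<in> L2 Omega"
proof -
  note V_measurable[measurable]
  have [measurable]: "v \<in> borel_measurable (lebesgue_on Omega)"
    using assms by (rule L2_measurable)
  have "integrable (lebesgue_on Omega) (\<lambda>x. (norm (complex_of_real (V x) * v x))\<^sup>2)"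
  proof (rule Bochner_Integration.integrable_bound)
    show "integrable (lebesgue_on Omega) (\<lambda>x. Vmax\<^sup>2 * (norm (v x))\<^sup>2)"
      using assms by (simp add: L2_def)
    have "(V x)\<^sup>2 \<le> Vmax\<^sup>2" if "x \<in> Omega" for x
      using V_bounds[OF that] Vmin by (intro power_mono) auto
    then show "AE x in lebesgue_on Omega. norm ((norm (complex_of_real (V x) * v x))\<^sup>2) \<le> norm (Vmax\<^sup>2 * (norm (v x))\<^sup>2)"
      by (intro AE_I2) (auto simp: norm_mult power_mult_distrib intro!: mult_right_mono)
  qed measurable
  then show ?thesis by (simp add: L2_def)
qed

lemma aform_add_left:
  assumes "v \<in> H1" "v' \<in> H1" "w \<in> H1"
  shows "aform \<epsilon> V (\<lambda>x. v x + v' x) w = aform \<epsilon> V v w + aform \<epsilon> V v' w"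
proof -
  have "L2inner_vec (grad (\<lambda>x. v x + v' x)) (grad w) = L2inner_vec (\<lambda>x. grad v x + grad v' x) (grad w)"
    by (intro L2inner_vec_cong_AE grad_add grad_H1 H1_add L2_add assms)
  then show ?thesis
    using assms by (simp add: aform_def L2inner_vec_add_left grad_H1 distrib_left L2inner_add_left mult_V_L2 H1_L2)
qed

lemma aform_cmult_left:
  assumes "v \<in> H1" "w \<in> H1"
  shows "aform \<epsilon> V (\<lambda>x. c * v x) w = c * aform \<epsilon> V v w"
proof -
  have "L2inner_vec (grad (\<lambda>x. c * v x)) (grad w) = L2inner_vec (\<lambda>x. c *s grad v x) (grad w)"
    by (intro L2inner_vec_cong_AE grad_cmult grad_H1 H1_cmult L2_bounded_linear[OF _ bounded_linear_smult] assms)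
  moreover have "L2inner (\<lambda>x. of_real (V x) * (c * v x)) w = c * L2inner (\<lambda>x. of_real (V x) * v x) w"
    by (simp add: L2inner_cmult_left[symmetric] mult.left_commute)
  ultimately show ?thesis
    by (simp add: aform_def L2inner_vec_cmult_left algebra_simps)
qed

lemma aform_commute: "aform \<epsilon> V v w = cnj (aform \<epsilon> V w v)"
proof -
  have "L2inner (\<lambda>x. of_real (V x) * v x) w = cnj (L2inner (\<lambda>x. of_real (V x) * w x) v)"
    by (simp add: L2inner_def Bochner_Integration.integral_cnj[symmetric] mult_ac
        del: Bochner_Integration.integral_cnj)
  then show ?thesis
    by (simp add: aform_def L2inner_vec_commute[of "grad v"])
qed

lemma aform_diff_left:
  assumes "v \<in> H1" "v' \<in> H1" "w \<in> H1"
  shows "aform \<epsilon> V (\<lambda>x. v x - v' x) w = aform \<epsilon> V v w - aform \<epsilon> V v' w"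
  using aform_add_left[OF assms(1) H1_cmult[OF assms(2)] assms(3), of "-1"]
    aform_cmult_left[OF assms(2,3), of "-1"] by simp

lemma aform_sum_left:
  assumes "finite I" "\<And>i. i \<in> I \<Longrightarrow> f i \<in> H1P" "w \<in> H1P"
  shows "aform \<epsilon> V (\<lambda>x. \<Sum>i\<in>I. f i x) w = (\<Sum>i\<in>I. aform \<epsilon> V (f i) w)"
  using assms
proof (induction I rule: finite_induct)
  case empty
  then show ?case
    \<comment> \<open>The empty sum is the zero function, seen as 0 times itself; homogeneity then
      gives the value 0.\<close>
    using aform_cmult_left[OF H1P_H1 H1P_H1, OF H1P_0 empty(2), of 0] by simp
next
  case (insert i I)
  then show ?case by (simp add: aform_add_left H1P_H1 H1P_sum)
qed

lemma Re_aform_self: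
  assumes "w \<in> H1"
  shows "Re (aform \<epsilon> V w w) = \<epsilon>\<^sup>2 / 2 * (L2norm Omega (grad w))\<^sup>2
    + (LINT x|lebesgue_on Omega. V x * (norm (w x))\<^sup>2)"
proof -
  have "L2inner (\<lambda>x. of_real (V x) * w x) w = (LINT x|lebesgue_on Omega. of_real (V x * (norm (w x))\<^sup>2))"
    unfolding L2inner_def of_real_mult complex_norm_square by (simp add: mult.assoc)
  then show ?thesis
    unfolding aform_def L2inner_vec_self by (simp only: integral_complex_of_real) simp
qed

text \<open>Coercivity. The gradient term yields the bound of the gradient by the energy norm, and
  the term with \<open>Vmin\<close> shows that a function of zero energy has zero norm.\<close>

lemma Re_aform_self_ge:
  assumes w: "w \<in> H1"
  shows "\<epsilon>\<^sup>2 / 2 * (L2norm Omega (grad w))\<^sup>2 + Vmin * (L2norm Omega w)\<^sup>2 \<le> Re (aform \<epsilon> V w w)"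
proof -
  note V_measurable[measurable]
  have wL: "w \<in> L2 Omega" by (rule H1_L2[OF w])
  then have [measurable]: "w \<in> borel_measurable (lebesgue_on Omega)" by (rule L2_measurable)
  have int: "integrable (lebesgue_on Omega) (\<lambda>x. (norm (w x))\<^sup>2)"
    using wL by (simp add: L2_def)
  have "(LINT x|lebesgue_on Omega. Vmin * (norm (w x))\<^sup>2) \<le> (LINT x|lebesgue_on Omega. V x * (norm (w x))\<^sup>2)"
  proof (rule integral_mono)
    show "integrable (lebesgue_on Omega) (\<lambda>x. V x * (norm (w x))\<^sup>2)"
    proof (rule Bochner_Integration.integrable_bound)
      show "integrable (lebesgue_on Omega) (\<lambda>x. Vmax * (norm (w x))\<^sup>2)" using int by simp
      show "AE x in lebesgue_on Omega. norm (V x * (norm (w x))\<^sup>2) \<le> norm (Vmax * (norm (w x))\<^sup>2)"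
      proof (intro AE_I2)
        fix x :: "real^'n" assume "x \<in> space (lebesgue_on Omega)"
        then have "Vmin \<le> V x \<and> V x \<le> Vmax" using V_bounds by simp
        then show "norm (V x * (norm (w x))\<^sup>2) \<le> norm (Vmax * (norm (w x))\<^sup>2)"
          using Vmin by (auto simp: abs_mult intro!: mult_right_mono)
      qed
    qed measurable
  qed (use int V_bounds in \<open>auto intro!: mult_right_mono\<close>)
  then show ?thesis
    by (simp add: Re_aform_self[OF w] L2norm_sq)
qed

lemma Re_aform_self_nonneg: "w \<in> H1 \<Longrightarrow> 0 \<le> Re (aform \<epsilon> V w w)"
  using Re_aform_self_ge[of w] Vmin by (smt (verit) mult_nonneg_nonneg zero_le_power2 divide_nonneg_nonneg)

lemma energy_norm_sq: "w \<in> H1 \<Longrightarrow> (energy_norm \<epsilon> V w)\<^sup>2 = Re (aform \<epsilon> V w w)"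
  by (simp add: energy_norm_def Re_aform_self_nonneg)

lemma L2norm_grad_le_energy_norm:
  assumes w: "w \<in> H1"
  shows "L2norm Omega (grad w) \<le> sqrt 2 / \<epsilon> * energy_norm \<epsilon> V w"
proof (rule power2_le_imp_le)
  have "0 \<le> Vmin * (L2norm Omega w)\<^sup>2" using Vmin by simp
  then have "\<epsilon>\<^sup>2 / 2 * (L2norm Omega (grad w))\<^sup>2 \<le> (energy_norm \<epsilon> V w)\<^sup>2"
    using Re_aform_self_ge[OF w] energy_norm_sq[OF w] by linarith
  then show "(L2norm Omega (grad w))\<^sup>2 \<le> (sqrt 2 / \<epsilon> * energy_norm \<epsilon> V w)\<^sup>2"
    using eps by (simp add: power_mult_distrib power_divide field_simps)
qed (use eps Re_aform_self_nonneg[OF w] in \<open>simp add: energy_norm_def\<close>)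

end

text \<open>V is smooth, hence continuous, only on the interior. Adding the frontier changes the
  domain by a negligible set and preserves measurability.\<close>

lemma smooth_on_interior_Omega_measurable:
  fixes V :: "real^'n \<Rightarrow> real"
  assumes "smooth_on (interior Omega) V"
  shows "V \<in> borel_measurable (lebesgue_on Omega)"
proof -
  have "V differentiable_on interior Omega"
    using assms[unfolded smooth_on_def, rule_format, of "[]"] by simp
  then have "V \<in> borel_measurable (lebesgue_on (interior Omega))"
    by (intro continuous_imp_measurable_on_sets_lebesgue differentiable_imp_continuous_on) simp_all
  then have "V measurable_on interior Omega"
    by (simp add: measurable_on_iff_borel_measurable)
  moreover have "negligible (sym_diff (interior Omega) (Omega :: (real^'n) set))"
    by (rule negligible_subset[OF negligible_convex_frontier[of "Omega :: (real^'n) set"]])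
      (use box_subset_cbox[of 0 "\<chi> i. 2 * pi"] in \<open>auto simp: Omega_def frontier_def\<close>)
  ultimately show ?thesis
    using measurable_on_spike_set measurable_on_iff_borel_measurable[OF Omega_sets] by blast
qed

lemma potential_elliptic_form:
  assumes "0 < \<epsilon>" "0 < Vmin" "potential Vmin Vmax CV \<delta> V"
  shows "elliptic_form \<epsilon> Vmin Vmax V"
  using assms smooth_on_interior_Omega_measurable
  by unfold_locales (auto simp: potential_def)

section \<open>Interpolation error on the whole domain\<close>

text \<open>Outside the finitely many null sets where two members meet, the indicator of the union
  is the sum of the indicators.\<close>

lemma integral_Union_negligible_overlap:
  fixes h :: "'a::euclidean_space \<Rightarrow> real"
  assumes fin: "finite \<S>" and meas: "\<And>G. G \<in> \<S> \<Longrightarrow> G \<in> sets lebesgue"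
    and overlap: "\<And>G G'. G \<in> \<S> \<Longrightarrow> G' \<in> \<S> \<Longrightarrow> G \<noteq> G' \<Longrightarrow> negligible (G \<inter> G')"
    and int: "integrable (lebesgue_on (\<Union>\<S>)) h"
  shows "(LINT x|lebesgue_on (\<Union>\<S>). h x) = (\<Sum>G\<in>\<S>. LINT x|lebesgue_on G. h x)"
proof -
  have U: "\<Union>\<S> \<in> sets lebesgue" using fin meas by auto
  have int': "integrable lebesgue (\<lambda>x. indicator (\<Union>\<S>) x *\<^sub>R h x)"
    using int U by (simp add: integrable_restrict_space)
  have intG: "integrable lebesgue (\<lambda>x. indicator G x *\<^sub>R h x)" if "G \<in> \<S>" for G
    using integrable_mult_indicator[OF meas[OF that] int']
    by (rule Bochner_Integration.integrable_cong[OF refl, THEN iffD1, rotated])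
       (use that in \<open>auto simp: indicator_def\<close>)
  have "AE x in lebesgue. \<forall>p\<in>{(G, G'). G \<in> \<S> \<and> G' \<in> \<S> \<and> G \<noteq> G'}. x \<notin> fst p \<inter> snd p"
  proof (rule AE_finite_allI)
    show "finite {(G, G'). G \<in> \<S> \<and> G' \<in> \<S> \<and> G \<noteq> G'}"
      by (rule finite_subset[of _ "\<S> \<times> \<S>"]) (use fin in auto)
    show "AE x in lebesgue. x \<notin> fst p \<inter> snd p" if "p \<in> {(G, G'). G \<in> \<S> \<and> G' \<in> \<S> \<and> G \<noteq> G'}" for p
    proof (rule AE_not_in)
      show "fst p \<inter> snd p \<in> null_sets lebesgue"
        using overlap[of "fst p" "snd p"] that by (simp add: negligible_iff_null_sets split_beta)
    qed
  qed
  then have "AE x in lebesgue. indicator (\<Union>\<S>) x *\<^sub>R h x = (\<Sum>G\<in>\<S>. indicator G x *\<^sub>R h x)"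
  proof eventually_elim
    case (elim x)
    show ?case
    proof (cases "x \<in> \<Union>\<S>")
      case True
      then obtain G where G: "G \<in> \<S>" "x \<in> G" by auto
      have "(\<Sum>G'\<in>\<S>. indicator G' x *\<^sub>R h x) = (\<Sum>G'\<in>\<S>. if G' = G then h x else 0)"
        using elim G by (intro sum.cong) (auto simp: indicator_def)
      then show ?thesis using True G fin by simp
    qed (auto simp: indicator_def)
  qed
  then have "(LINT x|lebesgue. indicator (\<Union>\<S>) x *\<^sub>R h x) = (LINT x|lebesgue. (\<Sum>G\<in>\<S>. indicator G x *\<^sub>R h x))"
    using int' intG by (intro integral_cong_AE) auto
  also have "\<dots> = (\<Sum>G\<in>\<S>. LINT x|lebesgue. indicator G x *\<^sub>R h x)"
    by (rule Bochner_Integration.integral_sum[OF intG])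
  also have "\<dots> = (\<Sum>G\<in>\<S>. LINT x|lebesgue_on G. h x)"
    using meas by (intro sum.cong) (simp_all add: integral_restrict_space)
  finally show ?thesis
    using U by (simp add: integral_restrict_space)
qed

section \<open>Geometry of the mesh\<close>

lemma periodic_meshD:
  fixes \<T> :: "(real^'n) set set"
  assumes "periodic_mesh \<T>"
  shows "finite \<T>" "\<Union>\<T> = Omega" "T \<in> \<T> \<Longrightarrow> int CARD('n) simplex T"
    and "T \<in> \<T> \<Longrightarrow> S \<in> \<T> \<Longrightarrow> T \<inter> S face_of T \<and> T \<inter> S face_of S"
proof -
  have "triangulation \<T> \<and> (\<forall>T\<in>\<T>. int CARD('n) simplex T) \<and> \<Union>\<T> = Omega"
    using assms unfolding periodic_mesh_def by blast
  then show "finite \<T>" "\<Union>\<T> = Omega" "T \<in> \<T> \<Longrightarrow> int CARD('n) simplex T"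
    by (auto simp: triangulation_def)
  have *: "\<forall>T\<in>\<T>. \<forall>S\<in>\<T>. \<forall>k. (\<forall>i. k $ i \<in> \<int>) \<longrightarrow>
        (let S' = (\<lambda>x. x + (2 * pi) *\<^sub>R k) ` S in T \<inter> S' face_of T \<and> T \<inter> S' face_of S')"
    using assms unfolding periodic_mesh_def by blast
  show "T \<in> \<T> \<Longrightarrow> S \<in> \<T> \<Longrightarrow> T \<inter> S face_of T \<and> T \<inter> S face_of S"
    \<comment> \<open>The zero shift recovers the face-to-face property of the mesh itself.\<close>
    using *[rule_format, of T S 0] by simp
qed

text \<open>The intersection is a face of both elements. If it were all of T, then T would be a
  proper face of S of the same dimension. So it is a proper face of T, has lower dimension and empty
  interior, and is negligible by convexity.\<close>

lemma periodic_mesh_negligible_overlap: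
  fixes \<T> :: "(real^'n) set set"
  assumes m: "periodic_mesh \<T>" and T: "T \<in> \<T>" and S: "S \<in> \<T>" and ne: "T \<noteq> S"
  shows "negligible (T \<inter> S)"
proof -
  have dim: "aff_dim T = int CARD('n)" "aff_dim S = int CARD('n)"
    and conv: "convex T" "convex S"
    using periodic_meshD(3)[OF m] T S aff_dim_simplex convex_simplex by blast+
  have f: "T \<inter> S face_of T" "T \<inter> S face_of S"
    using periodic_meshD(4)[OF m T S] by blast+
  have "T \<inter> S \<noteq> T"
  proof
    assume "T \<inter> S = T"
    then have "T face_of S" using f(2) by metis
    then show False using face_of_aff_dim_lt[OF conv(2) _ ne] dim by linarith
  qed
  then have "aff_dim (T \<inter> S) < int CARD('n)"
    using face_of_aff_dim_lt[OF conv(1) f(1)] dim by linarith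
  then have "interior (T \<inter> S) = {}"
    by (intro low_dim_interior) simp
  then show ?thesis
    using negligible_convex_interior[OF convex_Int[OF conv]] by blast
qed

text \<open>A set of diameter 0 has at most one point, hence affine dimension at most 0.\<close>

lemma simplex_diameter_pos:
  assumes "n simplex T" "0 < n"
  shows "0 < diameter T"
proof (rule ccontr)
  assume "\<not> 0 < diameter T"
  have b: "bounded T" using compact_simplex[OF assms(1)] compact_imp_bounded by blast
  have "x = y" if "x \<in> T" "y \<in> T" for x y
    using diameter_bounded_bound[OF b that] \<open>\<not> 0 < diameter T\<close> by (simp add: not_less) (meson order_trans zero_le_dist dist_le_zero_iff)
  then have "T = {} \<or> (\<exists>a. T = {a})" by blast
  then have "aff_dim T \<le> 0" by auto
  then show False using aff_dim_simplex[OF assms(1)] assms(2) by simp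
qed

lemma periodic_mesh_nonempty:
  assumes "periodic_mesh \<T>"
  shows "\<T> \<noteq> {}"
proof -
  have "(0 :: real^'a) \<in> Omega" by (auto simp: Omega_def mem_box_cart)
  then show ?thesis using periodic_meshD(2)[OF assms] by auto
qed

lemma mesh_size_pos:
  fixes \<T> :: "(real^'n) set set"
  assumes m: "periodic_mesh \<T>"
  shows "0 < mesh_size \<T>"
proof -
  obtain T where T: "T \<in> \<T>" using periodic_mesh_nonempty[OF m] by blast
  have "0 < diameter T" by (rule simplex_diameter_pos[OF periodic_meshD(3)[OF m T]]) simp
  also have "\<dots> \<le> mesh_size \<T>"
    unfolding mesh_size_def using T periodic_meshD(1)[OF m] by (intro Max_ge) auto
  finally show ?thesis .
qed

text \<open>Each element is a polyhedron and has finitely many extreme points. Finiteness matters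
  since a sum over an infinite index set would be 0 by convention.\<close>

lemma finite_nodes:
  assumes m: "periodic_mesh \<T>"
  shows "finite (nodes \<T>)"
proof -
  have "vertices \<T> = (\<Union>T\<in>\<T>. {z. z extreme_point_of T})"
    by (auto simp: vertices_def)
  also have "finite \<dots>"
    using periodic_meshD(1,3)[OF m]
    by (auto intro!: finite_polyhedron_extreme_points simplex_imp_polyhedron)
  finally show ?thesis
    by (rule rev_finite_subset) (auto simp: nodes_def)
qed

section \<open>From local to global norms\<close>

lemma L2_subset:
  assumes "f \<in> L2 S" "S \<in> sets lebesgue" "T \<in> sets lebesgue" "T \<subseteq> S"
  shows "f \<in> L2 T"
proof -
  have e: "lebesgue_on T = restrict_space (lebesgue_on S) T"
    using assms(4) by (simp add: restrict_restrict_space Int_absorb1 assms)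
  have "T \<in> sets (lebesgue_on S)"
    using assms by (auto simp: sets_restrict_space)
  then have "integrable (lebesgue_on T) (\<lambda>x. (norm (f x))\<^sup>2)"
    unfolding e using assms(1,4) 
    by (subst integrable_restrict_space) (auto simp: L2_def Int_absorb2 simp del: real_scaleR_def intro!: integrable_mult_indicator)
  moreover have "f \<in> borel_measurable (lebesgue_on T)"
    unfolding e using assms(1) by (intro measurable_restrict_space1 L2_measurable)
  ultimately show ?thesis by (simp add: L2_def)
qed

lemma L2norm_sq_Union:
  fixes \<T> :: "(real^'n) set set" and f :: "real^'n \<Rightarrow> 'b::euclidean_space"
  assumes m: "periodic_mesh \<T>" and sub: "\<S> \<subseteq> \<T>" and f: "f \<in> L2 Omega"
  shows "(L2norm (\<Union>\<S>) f)\<^sup>2 = (\<Sum>G\<in>\<S>. (L2norm G f)\<^sup>2)"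
proof -
  have meas: "G \<in> sets lebesgue" if "G \<in> \<T>" for G
    using compact_simplex[OF periodic_meshD(3)[OF m that]] by (simp add: borel_compact)
  have fin: "finite \<S>" using finite_subset[OF sub periodic_meshD(1)[OF m]] .
  have "f \<in> L2 (\<Union>\<S>)"
    using fin sub meas periodic_meshD(2)[OF m] by (intro L2_subset[OF f Omega_sets] sets.finite_Union) auto
  then show ?thesis
    unfolding L2norm_sq
  proof (intro integral_Union_negligible_overlap fin)
    show "negligible (G \<inter> G')" if "G \<in> \<S>" "G' \<in> \<S>" "G \<noteq> G'" for G G'
      using periodic_mesh_negligible_overlap[OF m] that sub by blast
  qed (use sub meas in \<open>auto simp: L2_def\<close>)
qed

text \<open>Summing the local bound over all elements counts every element at most \<open>Col\<close> times, because
  adjacency is symmetric.\<close>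

lemma interp_error_bound:
  fixes \<T> :: "(real^'n) set set"
  assumes m: "periodic_mesh \<T>" and "0 < Col" "0 < CI"
    and ov: "overlap_bound Col \<T>" and ib: "interp_bound CI \<T> \<phi>"
    and v: "v \<in> H1P" and d: "(\<lambda>x. v x - interp \<T> \<phi> v x) \<in> L2 Omega"
  shows "L2norm Omega (\<lambda>x. v x - interp \<T> \<phi> v x) \<le> CI * sqrt Col * mesh_size \<T> * L2norm Omega (grad v)"
proof (rule power2_le_imp_le)
  define H where "H = mesh_size \<T>"
  have H: "0 < H" unfolding H_def by (rule mesh_size_pos[OF m])
  define d where "d = (\<lambda>x. v x - interp \<T> \<phi> v x)"
  define R where "R = (\<lambda>T G :: (real^'n) set. periodic_hull G \<inter> periodic_hull T \<noteq> {})"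
  have R_sym: "R T G \<longleftrightarrow> R G T" for T G by (auto simp: R_def)
  have nbhd: "nbhd \<T> T = \<Union>{G \<in> \<T>. R T G}" for T by (simp add: nbhd_def R_def)
  have fin: "finite \<T>" using periodic_meshD(1)[OF m] .
  have g: "grad v \<in> L2 Omega" by (intro grad_H1 H1P_H1 v)
  have loc: "(L2norm T d)\<^sup>2 \<le> (CI * H)\<^sup>2 * (\<Sum>G | G \<in> \<T> \<and> R T G. (L2norm G (grad v))\<^sup>2)" if T: "T \<in> \<T>" for T
  proof -
    have "L2norm T d / H + L2norm T (grad d) \<le> CI * L2norm (nbhd \<T> T) (grad v)"
      using ib T v unfolding interp_bound_def d_def H_def by blast
    \<comment> \<open>The local bound also controls the gradient of the error, a nonnegative term
      that is dropped.\<close>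
    then have "L2norm T d / H \<le> CI * L2norm (nbhd \<T> T) (grad v)"
      using L2norm_nonneg[of T "grad d"] by linarith
    then have "L2norm T d \<le> CI * H * L2norm (nbhd \<T> T) (grad v)"
      using H by (simp add: field_simps)
    then have "(L2norm T d)\<^sup>2 \<le> (CI * H * L2norm (nbhd \<T> T) (grad v))\<^sup>2"
      by (intro power_mono) auto
    moreover have "(L2norm (nbhd \<T> T) (grad v))\<^sup>2 = (\<Sum>G | G \<in> \<T> \<and> R T G. (L2norm G (grad v))\<^sup>2)"
      unfolding nbhd by (rule L2norm_sq_Union[OF m _ g]) auto
    ultimately show ?thesis by (simp add: power_mult_distrib)
  qed
  have count: "real (card {T \<in> \<T>. R T G}) \<le> Col" if G: "G \<in> \<T>" for G
  proof -
    have "card {T \<in> \<T>. R T G} \<le> card {T \<in> \<T>. T \<subseteq> nbhd \<T> G}"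
      using fin by (intro card_mono) (auto simp: nbhd R_sym)
    also have "real \<dots> \<le> Col" using ov G by (simp add: overlap_bound_def)
    finally show ?thesis by simp
  qed
  have "(L2norm Omega d)\<^sup>2 = (\<Sum>T\<in>\<T>. (L2norm T d)\<^sup>2)"
    using L2norm_sq_Union[OF m subset_refl] assms(7) periodic_meshD(2)[OF m] by (simp add: d_def)
  also have "\<dots> \<le> (\<Sum>T\<in>\<T>. (CI * H)\<^sup>2 * (\<Sum>G | G \<in> \<T> \<and> R T G. (L2norm G (grad v))\<^sup>2))"
    by (intro sum_mono loc)
  also have "\<dots> = (CI * H)\<^sup>2 * (\<Sum>G\<in>\<T>. \<Sum>T | T \<in> \<T> \<and> R T G. (L2norm G (grad v))\<^sup>2)"
    by (simp add: sum_distrib_left[symmetric] sum.swap_restrict[OF fin fin])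
  also have "\<dots> \<le> (CI * H)\<^sup>2 * (\<Sum>G\<in>\<T>. Col * (L2norm G (grad v))\<^sup>2)"
    using count by (intro mult_left_mono sum_mono) (auto intro: mult_right_mono)
  also have "\<dots> = (CI * H)\<^sup>2 * (Col * (L2norm Omega (grad v))\<^sup>2)"
    using L2norm_sq_Union[OF m subset_refl g] periodic_meshD(2)[OF m] by (simp add: sum_distrib_left[symmetric])
  also have "\<dots> = (CI * sqrt Col * H * L2norm Omega (grad v))\<^sup>2"
    using assms by (simp add: power_mult_distrib)
  finally show "(L2norm Omega (\<lambda>x. v x - interp \<T> \<phi> v x))\<^sup>2 \<le> (CI * sqrt Col * mesh_size \<T> * L2norm Omega (grad v))\<^sup>2"
    by (simp add: d_def H_def)
qed (use assms mesh_size_pos[OF m] in simp)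

section \<open>The Galerkin error\<close>

lemma L2inner_sum_left:
  assumes "\<And>i. i \<in> I \<Longrightarrow> f i \<in> L2 Omega" "g \<in> L2 Omega"
  shows "L2inner (\<lambda>x. \<Sum>i\<in>I. c i * f i x) g = (\<Sum>i\<in>I. c i * L2inner (f i) g)"
proof -
  have "L2inner (\<lambda>x. \<Sum>i\<in>I. c i * f i x) g = (LINT x|lebesgue_on Omega. (\<Sum>i\<in>I. c i * (f i x * cnj (g x))))"
    by (simp add: L2inner_def sum_distrib_right mult.assoc)
  also have "\<dots> = (\<Sum>i\<in>I. LINT x|lebesgue_on Omega. c i * (f i x * cnj (g x)))"
    using assms by (intro Bochner_Integration.integral_sum integrable_mult_right L2inner_integrable)
  finally show ?thesis by (simp add: L2inner_def)
qed

lemma interp_in_H1P: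
  assumes "periodic_mesh \<T>" "nodal_basis \<T> \<phi>"
  shows "interp \<T> \<phi> v \<in> H1P"
  using assms(2) unfolding interp_def[abs_def]
  by (intro H1P_sum H1P_cmult finite_nodes assms(1)) (auto simp: nodal_basis_def PhiH_def)

lemma nodal_basis_H1P: "nodal_basis \<T> \<phi> \<Longrightarrow> z \<in> nodes \<T> \<Longrightarrow> \<phi> z \<in> H1P"
  by (auto simp: nodal_basis_def PhiH_def)

lemma interp_eq_0:
  assumes "\<And>z. z \<in> nodes \<T> \<Longrightarrow> L2inner v (\<phi> z) = 0"
  shows "interp \<T> \<phi> v = (\<lambda>_. 0)"
  using assms by (simp add: interp_def fun_eq_iff)

text \<open>The interpolation is a combination of nodal basis functions, to which w is orthogonal.
  Used to subtract the interpolation of f from f in the product with the error.\<close>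

lemma L2inner_interp_eq_0:
  assumes m: "periodic_mesh \<T>" and nb: "nodal_basis \<T> \<phi>" and w: "w \<in> L2 Omega"
    and orth: "\<And>z. z \<in> nodes \<T> \<Longrightarrow> L2inner w (\<phi> z) = 0"
  shows "L2inner (interp \<T> \<phi> v) w = 0"
proof -
  have "L2inner (\<phi> z) w = 0" if "z \<in> nodes \<T>" for z
    using orth[OF that] L2inner_commute[of "\<phi> z" w] by simp
  then show ?thesis
    unfolding interp_def[abs_def]
    by (subst L2inner_sum_left) (simp_all add: H1P_L2[OF nodal_basis_H1P[OF nb]] w)
qed

context elliptic_form
begin

text \<open>The energy along a complex line, for the first variation in
  \<open>aform_arg_min_eq_0\<close>. Linearity on the left and Hermitian symmetry suffice; the
  latter brings in \<open>cnj t\<close>.\<close>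

lemma Re_aform_add_cmult:
  assumes p: "p \<in> H1" and w: "w \<in> H1"
  shows "Re (aform \<epsilon> V (\<lambda>x. p x + t * w x) (\<lambda>x. p x + t * w x)) =
    Re (aform \<epsilon> V p p) + 2 * Re (cnj t * aform \<epsilon> V p w) + (norm t)\<^sup>2 * Re (aform \<epsilon> V w w)"
proof -
  let ?x = "\<lambda>x. p x + t * w x"
  have left: "aform \<epsilon> V ?x v = aform \<epsilon> V p v + t * aform \<epsilon> V w v" if "v \<in> H1" for v
    using aform_add_left[OF p H1_cmult[OF w] that] aform_cmult_left[OF w that] by simp
  have x: "?x \<in> H1" by (intro H1_add H1_cmult p w)
  have "aform \<epsilon> V ?x ?x = aform \<epsilon> V p ?x + t * aform \<epsilon> V w ?x"
    by (rule left[OF x])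
  also have "\<dots> = cnj (aform \<epsilon> V ?x p) + t * cnj (aform \<epsilon> V ?x w)"
    by (simp only: aform_commute[of p ?x] aform_commute[of w ?x])
  also have "\<dots> = cnj (aform \<epsilon> V p p) + cnj t * aform \<epsilon> V p w
      + cnj (cnj t * aform \<epsilon> V p w) + of_real ((norm t)\<^sup>2) * cnj (aform \<epsilon> V w w)"
    unfolding left[OF p] left[OF w] aform_commute[of w p] complex_norm_square
    by (simp add: algebra_simps)
  finally show ?thesis by simp
qed

text \<open>Adding a multiple of w changes no moment, so p + t w is admissible and cannot have
  smaller energy. With t a small negative multiple of A = a(p, w), the linear term would dominate
  the quadratic one unless A = 0; a complex t handles both parts of A at once.\<close>

lemma aform_arg_min_eq_0:
  assumes min: "is_arg_min (\<lambda>\<xi>. Re (aform \<epsilon> V \<xi> \<xi>)) (\<lambda>\<xi>. \<xi> \<in> dual_to \<T> \<phi> z) p"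
    and w: "w \<in> H1P" and orth: "\<And>z'. z' \<in> nodes \<T> \<Longrightarrow> L2inner w (\<phi> z') = 0"
    and \<phi>: "\<And>z'. z' \<in> nodes \<T> \<Longrightarrow> \<phi> z' \<in> L2 Omega"
  shows "aform \<epsilon> V p w = 0"
proof -
  define A where "A = aform \<epsilon> V p w"
  define B where "B = Re (aform \<epsilon> V w w)"
  have B: "0 \<le> B" unfolding B_def by (rule Re_aform_self_nonneg[OF H1P_H1[OF w]])
  have p: "p \<in> H1P" "\<And>z'. z' \<in> nodes \<T> \<Longrightarrow> L2inner p (\<phi> z') = (if z' = z then 1 else 0)"
    using min by (auto simp: is_arg_min_def dual_to_def)
  have dual: "(\<lambda>x. p x + t * w x) \<in> dual_to \<T> \<phi> z" for t
    unfolding dual_to_def mem_Collect_eq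
  proof (intro conjI ballI)
    show "(\<lambda>x. p x + t * w x) \<in> H1P" by (intro H1P_add H1P_cmult p w)
    fix z' assume "z' \<in> nodes \<T>"
    then show "L2inner (\<lambda>x. p x + t * w x) (\<phi> z') = (if z' = z then 1 else 0)"
      using L2inner_add_left[OF H1P_L2[OF p(1)] H1P_L2[OF H1P_cmult[OF w]] \<phi>] p(2) orth
      by (simp add: L2inner_cmult_left)
  qed
  have ge: "0 \<le> 2 * Re (cnj t * A) + (norm t)\<^sup>2 * B" for t
    using min dual[of t] Re_aform_add_cmult[OF H1P_H1[OF p(1)] H1P_H1[OF w], of t]
    unfolding is_arg_min_def A_def B_def by fastforce
  \<comment> \<open>The denominator B + 1 covers the case B = 0. Because s B is at most 1, the
    quadratic term uses up at most half of the linear gain.\<close>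
  define s where "s = 1 / (B + 1)"
  have s: "0 < s" "s * B \<le> 1" using B by (auto simp: s_def field_simps)
  have "Re (cnj (- of_real s * A) * A) = - s * (norm A)\<^sup>2"
    unfolding cmod_power2 by (simp add: power2_eq_square algebra_simps)
  moreover have "(norm (- of_real s * A))\<^sup>2 = s\<^sup>2 * (norm A)\<^sup>2"
    by (simp add: norm_mult power_mult_distrib)
  ultimately have "0 \<le> - 2 * s * (norm A)\<^sup>2 + s * (norm A)\<^sup>2 * (s * B)"
    using ge[of "- of_real s * A"] by (simp add: power2_eq_square algebra_simps)
  also have "\<dots> \<le> - 2 * s * (norm A)\<^sup>2 + s * (norm A)\<^sup>2 * 1"
    using s by (intro add_left_mono mult_left_mono) auto
  finally have "s * (norm A)\<^sup>2 \<le> 0" by simp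
  then show ?thesis
    using s by (simp add: mult_le_0_iff A_def)
qed

lemma galerkin_error:
  fixes \<T> :: "(real^'n) set set"
  assumes m: "periodic_mesh \<T>" and nb: "nodal_basis \<T> \<phi>" and mb: "multiscale_basis \<epsilon> V \<T> \<phi> \<psi>"
    and u: "u \<in> H1P" "\<forall>v\<in>H1P. aform \<epsilon> V u v = L2inner f v"
    and uH: "uH \<in> PsiH \<T> \<psi>" "\<forall>vH\<in>PsiH \<T> \<psi>. aform \<epsilon> V uH vH = L2inner f vH"
  defines "e \<equiv> \<lambda>x. u x - uH x"
  shows "e \<in> H1P" and "\<And>z. z \<in> nodes \<T> \<Longrightarrow> L2inner e (\<phi> z) = 0"
    and "aform \<epsilon> V e e = L2inner f e"
proof -
  have fin: "finite (nodes \<T>)" by (rule finite_nodes[OF m])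
  have \<phi>: "\<phi> z \<in> L2 Omega" if "z \<in> nodes \<T>" for z
    by (rule H1P_L2[OF nodal_basis_H1P[OF nb that]])
  have min: "is_arg_min (\<lambda>\<xi>. Re (aform \<epsilon> V \<xi> \<xi>)) (\<lambda>\<xi>. \<xi> \<in> dual_to \<T> \<phi> z) (\<psi> z)" if "z \<in> nodes \<T>" for z
    using mb that by (simp add: multiscale_basis_def)
  have \<psi>: "\<psi> z \<in> H1P" "\<And>z'. z' \<in> nodes \<T> \<Longrightarrow> L2inner (\<psi> z) (\<phi> z') = (if z' = z then 1 else 0)"
    if "z \<in> nodes \<T>" for z
    using min[OF that] by (auto simp: is_arg_min_def dual_to_def)
  have PsiH_H1P: "v \<in> H1P" if "v \<in> PsiH \<T> \<psi>" for v
    using that \<psi> fin by (auto simp: PsiH_def intro!: H1P_sum H1P_cmult)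
  show e: "e \<in> H1P"
    unfolding e_def by (intro H1P_diff u PsiH_H1P uH)
  have PsiH_orth: "aform \<epsilon> V v w = 0"
    if v: "v \<in> PsiH \<T> \<psi>" and w: "w \<in> H1P" "\<And>z. z \<in> nodes \<T> \<Longrightarrow> L2inner w (\<phi> z) = 0" for v w
  proof -
    obtain c where v: "v = (\<lambda>x. \<Sum>z\<in>nodes \<T>. c z * \<psi> z x)" using v by (auto simp: PsiH_def)
    have "aform \<epsilon> V v w = (\<Sum>z\<in>nodes \<T>. aform \<epsilon> V (\<lambda>x. c z * \<psi> z x) w)"
      unfolding v by (intro aform_sum_left fin H1P_cmult \<psi> w)
    also have "\<dots> = 0"
      using aform_arg_min_eq_0[OF min w \<phi>] \<psi> w by (intro sum.neutral ballI) (simp add: aform_cmult_left H1P_H1)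
    finally show ?thesis .
  qed
  \<comment> \<open>The element of the multiscale space with the same moments as e, so that w = e -
    eH has vanishing moments.\<close>
  define eH where "eH = (\<lambda>x. \<Sum>z\<in>nodes \<T>. L2inner e (\<phi> z) * \<psi> z x)"
  define w where "w = (\<lambda>x. e x - eH x)"
  have eH_Psi: "eH \<in> PsiH \<T> \<psi>" by (auto simp: PsiH_def eH_def)
  have eH: "eH \<in> H1P" by (rule PsiH_H1P[OF eH_Psi])
  have w: "w \<in> H1P" unfolding w_def by (intro H1P_diff e eH)
  have eH_moments: "L2inner eH (\<phi> z) = L2inner e (\<phi> z)" if z: "z \<in> nodes \<T>" for z
  proof -
    have "L2inner eH (\<phi> z) = (\<Sum>z'\<in>nodes \<T>. L2inner e (\<phi> z') * L2inner (\<psi> z') (\<phi> z))"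
      unfolding eH_def by (intro L2inner_sum_left H1P_L2 \<psi> \<phi> z)
    also have "\<dots> = (\<Sum>z'\<in>nodes \<T>. if z' = z then L2inner e (\<phi> z) else 0)"
      using \<psi> z by (intro sum.cong) auto
    also have "\<dots> = L2inner e (\<phi> z)" using z fin by simp
    finally show ?thesis .
  qed
  have w_orth: "L2inner w (\<phi> z) = 0" if "z \<in> nodes \<T>" for z
    using eH_moments[OF that] L2inner_diff_left[OF H1P_L2[OF e] H1P_L2[OF eH] \<phi>[OF that]] by (simp add: w_def)
  have "aform \<epsilon> V u eH = aform \<epsilon> V uH eH" using u uH eH eH_Psi by simp
  then have "aform \<epsilon> V e eH = 0"
    unfolding e_def using u uH eH PsiH_H1P by (simp add: aform_diff_left H1P_H1)
  moreover have "aform \<epsilon> V w eH = 0"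
    using PsiH_orth[OF eH_Psi w w_orth] aform_commute[of w eH] by simp
  \<comment> \<open>Both a(w, eH) and a(e, eH) are 0, the first by minimality and the second by
    Galerkin orthogonality; the difference a(eH, eH) is therefore 0 as well.\<close>
  moreover have "aform \<epsilon> V w eH = aform \<epsilon> V e eH - aform \<epsilon> V eH eH"
    unfolding w_def using e eH by (intro aform_diff_left H1P_H1)
  ultimately have "Re (aform \<epsilon> V eH eH) = 0" by simp
  then have "\<epsilon>\<^sup>2 / 2 * (L2norm Omega (grad eH))\<^sup>2 + Vmin * (L2norm Omega eH)\<^sup>2 \<le> 0"
    using Re_aform_self_ge[OF H1P_H1[OF eH]] by simp
  moreover have "0 \<le> \<epsilon>\<^sup>2 / 2 * (L2norm Omega (grad eH))\<^sup>2" by simp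
  ultimately have "Vmin * (L2norm Omega eH)\<^sup>2 \<le> 0" by linarith
  then have "L2norm Omega eH = 0"
    using Vmin by (simp add: mult_le_0_iff)
  \<comment> \<open>eH has norm 0 but need not vanish pointwise. Its moments, which are those of e,
    vanish by the Cauchy-Schwarz inequality.\<close>
  then show orth: "L2inner e (\<phi> z) = 0" if "z \<in> nodes \<T>" for z
    using L2inner_Cauchy_Schwarz[OF H1P_L2[OF eH] \<phi>[OF that]] eH_moments[OF that] by simp
  have "aform \<epsilon> V e e = aform \<epsilon> V u e - aform \<epsilon> V uH e"
    using u uH e PsiH_H1P by (subst (1) e_def) (intro aform_diff_left H1P_H1)
  then show "aform \<epsilon> V e e = L2inner f e"
    using PsiH_orth[OF uH(1) e orth] u e by simp
qed

text \<open>Writing P for the energy norm, F for the norm of g and M for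
  \<open>sqrt 2 * (c / \<epsilon>)\<close>, the bound on e gives norm at most M P, so P^2 is at most
  F M P. Cancelling P gives the first claim; inserting it into M P gives the second.\<close>

lemma energy_estimate:
  assumes e: "e \<in> H1P" and ae: "aform \<epsilon> V e e = L2inner g e" and g: "g \<in> L2 Omega"
    and le: "L2norm Omega e \<le> c * L2norm Omega (grad e)" and c: "0 \<le> c"
  shows "energy_norm \<epsilon> V e \<le> sqrt 2 * (c / \<epsilon>) * L2norm Omega g"
    and "L2norm Omega e \<le> 2 * (c / \<epsilon>)\<^sup>2 * L2norm Omega g"
proof -
  let ?P = "energy_norm \<epsilon> V e" and ?M = "sqrt 2 * (c / \<epsilon>)" and ?F = "L2norm Omega g"
  have P: "0 \<le> ?P" using Re_aform_self_nonneg[OF H1P_H1[OF e]] by (simp add: energy_norm_def)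
  have M: "0 \<le> ?M" using c eps by simp
  have "c * L2norm Omega (grad e) \<le> c * (sqrt 2 / \<epsilon> * ?P)"
    using L2norm_grad_le_energy_norm[OF H1P_H1[OF e]] c by (rule mult_left_mono)
  then have N: "L2norm Omega e \<le> ?M * ?P" using le by (simp add: algebra_simps)
  have "?P\<^sup>2 = Re (L2inner g e)" using energy_norm_sq[OF H1P_H1[OF e]] ae by simp
  also have "\<dots> \<le> ?F * L2norm Omega e"
    using complex_Re_le_cmod L2inner_Cauchy_Schwarz[OF g H1P_L2[OF e]] by (rule order_trans)
  also have "\<dots> \<le> ?F * (?M * ?P)" by (intro mult_left_mono N) simp
  finally have "?P * ?P \<le> (?M * ?F) * ?P" by (simp add: power2_eq_square mult_ac)
  \<comment> \<open>Covers the case P = 0, where P cannot be cancelled.\<close>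
  moreover have "0 \<le> ?M * ?F" using M by (rule mult_nonneg_nonneg) simp
  ultimately show bound: "?P \<le> ?M * ?F"
    using P by (metis mult_le_cancel_right less_le not_less)
  have "L2norm Omega e \<le> ?M * (?M * ?F)"
    using N mult_left_mono[OF bound M] by linarith
  also have "\<dots> = 2 * (c / \<epsilon>)\<^sup>2 * ?F" by (simp add: power2_eq_square)
  finally show "L2norm Omega e \<le> 2 * (c / \<epsilon>)\<^sup>2 * ?F" .
qed

end

section \<open>The four error estimates with a common constant\<close>

theorem theorem3p1:
  fixes Vmin Vmax \<kappa> q Col CI \<gamma> :: real and CV :: "nat \<Rightarrow> real"
  assumes "0 < Vmin" and "Vmin \<le> Vmax"
    and "0 < \<kappa>" and "0 < q" and "0 < Col" and "0 < CI" and "0 < \<gamma>"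
  shows "\<exists>C>0. \<forall>(\<epsilon>::real) (\<delta>::real) (V :: real^'n \<Rightarrow> real) (\<T> :: (real^'n) set set) (H::real) \<phi> \<psi> f u uH.
      0 < \<epsilon> \<and> \<epsilon> < 1 \<and> 0 < \<delta> \<and> \<delta> < 1 \<and>
      potential Vmin Vmax CV \<delta> V \<and>
      periodic_mesh \<T> \<and> shape_regular \<kappa> \<T> \<and> quasi_uniform q \<T> \<and> H = mesh_size \<T> \<and>
      nodal_basis \<T> \<phi> \<and>
      overlap_bound Col \<T> \<and> interp_bound CI \<T> \<phi> \<and> cutoff_bound \<gamma> \<T> \<and>
      H / \<epsilon> \<le> inverse (2 * CI * sqrt (Col * Vmax * (1 + CI * Col * \<gamma>))) \<and>
      multiscale_basis \<epsilon> V \<T> \<phi> \<psi> \<and>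
      f \<in> L2 Omega \<and>
      u \<in> H1P \<and> (\<forall>v\<in>H1P. aform \<epsilon> V u v = L2inner f v) \<and>
      uH \<in> PsiH \<T> \<psi> \<and> (\<forall>vH\<in>PsiH \<T> \<psi>. aform \<epsilon> V uH vH = L2inner f vH)
    \<longrightarrow>
      energy_norm \<epsilon> V (\<lambda>x. u x - uH x) \<le> C * (H / \<epsilon>) * L2norm Omega f \<and>
      L2norm Omega (\<lambda>x. u x - uH x) \<le> C * (H\<^sup>2 / \<epsilon>\<^sup>2) * L2norm Omega f \<and>
      (f \<in> H1P \<longrightarrow>
         energy_norm \<epsilon> V (\<lambda>x. u x - uH x) \<le> C * (H\<^sup>2 / \<epsilon>) * L2norm Omega (grad f) \<and>
         L2norm Omega (\<lambda>x. u x - uH x) \<le> C * (H ^ 3 / \<epsilon>\<^sup>2) * L2norm Omega (grad f))"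
proof -
  \<comment> \<open>The constant of \<open>interp_error_bound\<close>, apart from the mesh
    size.\<close>
  define K where "K = CI * sqrt Col"
  \<comment> \<open>A polynomial in K whose expansion dominates the four constants that occur:
    multiples of K, K^2 (twice) and K^3.\<close>
  define C where "C = (1 + 2 * K) ^ 3"
  have K: "0 < K" using assms by (simp add: K_def)
  have sqrt2: "sqrt 2 \<le> 2" by (rule real_le_lsqrt) auto
  have C_exp: "C = 1 + 6 * K + 12 * K\<^sup>2 + 8 * K ^ 3"
    by (simp add: C_def power3_eq_cube power2_eq_square algebra_simps)
  have pos: "0 < K\<^sup>2" "0 < K ^ 3" "sqrt 2 * K \<le> 2 * K" "sqrt 2 * K\<^sup>2 \<le> 2 * K\<^sup>2"
    using K sqrt2 by (simp_all add: mult_right_mono)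
  have C: "sqrt 2 * K \<le> C" "2 * K\<^sup>2 \<le> C" "sqrt 2 * K\<^sup>2 \<le> C" "2 * K ^ 3 \<le> C" "0 < C"
    unfolding C_exp using K pos by linarith+
  show ?thesis
  proof (intro exI[of _ C] conjI[OF C(5)] allI, rule impI)
    fix \<epsilon> \<delta> H :: real and V :: "real^'n \<Rightarrow> real" and \<T> :: "(real^'n) set set" and \<phi> \<psi> f u uH
    assume asm: "0 < \<epsilon> \<and> \<epsilon> < 1 \<and> 0 < \<delta> \<and> \<delta> < 1 \<and>
      potential Vmin Vmax CV \<delta> V \<and>
      periodic_mesh \<T> \<and> shape_regular \<kappa> \<T> \<and> quasi_uniform q \<T> \<and> H = mesh_size \<T> \<and>
      nodal_basis \<T> \<phi> \<and>
      overlap_bound Col \<T> \<and> interp_bound CI \<T> \<phi> \<and> cutoff_bound \<gamma> \<T> \<and>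
      H / \<epsilon> \<le> inverse (2 * CI * sqrt (Col * Vmax * (1 + CI * Col * \<gamma>))) \<and>
      multiscale_basis \<epsilon> V \<T> \<phi> \<psi> \<and>
      f \<in> L2 Omega \<and>
      u \<in> H1P \<and> (\<forall>v\<in>H1P. aform \<epsilon> V u v = L2inner f v) \<and>
      uH \<in> PsiH \<T> \<psi> \<and> (\<forall>vH\<in>PsiH \<T> \<psi>. aform \<epsilon> V uH vH = L2inner f vH)"
    let ?e = "\<lambda>x. u x - uH x"
    from asm have eps: "0 < \<epsilon>" and m: "periodic_mesh \<T>" and Hdef: "H = mesh_size \<T>"
      and nb: "nodal_basis \<T> \<phi>" and ov: "overlap_bound Col \<T>" and ib: "interp_bound CI \<T> \<phi>"
      and mb: "multiscale_basis \<epsilon> V \<T> \<phi> \<psi>" and f: "f \<in> L2 Omega"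
      and u: "u \<in> H1P" "\<forall>v\<in>H1P. aform \<epsilon> V u v = L2inner f v"
      and uH: "uH \<in> PsiH \<T> \<psi>" "\<forall>vH\<in>PsiH \<T> \<psi>. aform \<epsilon> V uH vH = L2inner f vH"
      and pot: "potential Vmin Vmax CV \<delta> V"
      by blast+
    interpret elliptic_form \<epsilon> Vmin Vmax V
      by (rule potential_elliptic_form[OF eps assms(1) pot])
    note err = galerkin_error[OF m nb mb u uH]
    have H: "0 < H" using mesh_size_pos[OF m] Hdef by simp
    have c: "0 \<le> K * H" using K H by simp
    \<comment> \<open>With zero interpolation, the interpolation estimate for e becomes a
      Poincare-type bound of e by its gradient.\<close>
    have e0: "interp \<T> \<phi> ?e = (\<lambda>_. 0)" by (rule interp_eq_0[OF err(2)])
    have le: "L2norm Omega ?e \<le> K * H * L2norm Omega (grad ?e)"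
      using interp_error_bound[OF m assms(5,6) ov ib err(1)] H1P_L2[OF err(1)]
      by (simp add: e0 K_def Hdef)
    note est = energy_estimate[OF err(1) err(3) f le c]
    have "sqrt 2 * (K * H / \<epsilon>) * L2norm Omega f \<le> C * (H / \<epsilon>) * L2norm Omega f"
      using mult_right_mono[OF C(1), of "H / \<epsilon> * L2norm Omega f"] H eps by (simp add: mult_ac)
    then have 1: "energy_norm \<epsilon> V ?e \<le> C * (H / \<epsilon>) * L2norm Omega f"
      using est(1) by linarith
    have "2 * (K * H / \<epsilon>)\<^sup>2 * L2norm Omega f \<le> C * (H\<^sup>2 / \<epsilon>\<^sup>2) * L2norm Omega f"
      using mult_right_mono[OF C(2), of "H\<^sup>2 / \<epsilon>\<^sup>2 * L2norm Omega f"]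
      by (simp add: mult_ac power_mult_distrib power_divide)
    then have 2: "L2norm Omega ?e \<le> C * (H\<^sup>2 / \<epsilon>\<^sup>2) * L2norm Omega f"
      using est(2) by linarith
    have 3: "energy_norm \<epsilon> V ?e \<le> C * (H\<^sup>2 / \<epsilon>) * L2norm Omega (grad f) \<and>
        L2norm Omega ?e \<le> C * (H ^ 3 / \<epsilon>\<^sup>2) * L2norm Omega (grad f)" if fP: "f \<in> H1P"
    proof -
      let ?g = "\<lambda>x. f x - interp \<T> \<phi> f x"
      have If: "interp \<T> \<phi> f \<in> L2 Omega" by (intro H1P_L2 interp_in_H1P m nb)
      have g: "?g \<in> L2 Omega" by (intro L2_diff f If)
      have gle: "L2norm Omega ?g \<le> K * H * L2norm Omega (grad f)"
        using interp_error_bound[OF m assms(5,6) ov ib fP g] by (simp add: K_def Hdef)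
      have "L2inner ?g ?e = L2inner f ?e"
        using L2inner_diff_left[OF f If H1P_L2[OF err(1)]]
          L2inner_interp_eq_0[OF m nb H1P_L2[OF err(1)] err(2)] by simp
      then have "aform \<epsilon> V ?e ?e = L2inner ?g ?e" using err(3) by simp
      \<comment> \<open>The same estimate with the interpolation error of f as data, whose norm
        \<open>gle\<close> bounds by K H times that of the gradient of f.\<close>
      note est = energy_estimate[OF err(1) this g le c]
      have "sqrt 2 * (K * H / \<epsilon>) * L2norm Omega ?g \<le> sqrt 2 * (K * H / \<epsilon>) * (K * H * L2norm Omega (grad f))"
        using c eps by (intro mult_left_mono gle) auto
      also have "\<dots> \<le> C * (H\<^sup>2 / \<epsilon>) * L2norm Omega (grad f)"
        using mult_right_mono[OF C(3), of "H\<^sup>2 / \<epsilon> * L2norm Omega (grad f)"] H eps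
        by (simp add: mult_ac power2_eq_square)
      finally have 1: "energy_norm \<epsilon> V ?e \<le> C * (H\<^sup>2 / \<epsilon>) * L2norm Omega (grad f)"
        using est(1) by linarith
      have "2 * (K * H / \<epsilon>)\<^sup>2 * L2norm Omega ?g \<le> 2 * (K * H / \<epsilon>)\<^sup>2 * (K * H * L2norm Omega (grad f))"
        by (intro mult_left_mono gle) auto
      also have "\<dots> \<le> C * (H ^ 3 / \<epsilon>\<^sup>2) * L2norm Omega (grad f)"
        using mult_right_mono[OF C(4), of "H ^ 3 / \<epsilon>\<^sup>2 * L2norm Omega (grad f)"] eps H
        by (simp add: mult_ac power2_eq_square power3_eq_cube)
      finally show ?thesis using 1 est(2) by linarith
    qed
    show "energy_norm \<epsilon> V ?e \<le> C * (H / \<epsilon>) * L2norm Omega f \<and>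
      L2norm Omega ?e \<le> C * (H\<^sup>2 / \<epsilon>\<^sup>2) * L2norm Omega f \<and>
      (f \<in> H1P \<longrightarrow>
         energy_norm \<epsilon> V ?e \<le> C * (H\<^sup>2 / \<epsilon>) * L2norm Omega (grad f) \<and>
         L2norm Omega ?e \<le> C * (H ^ 3 / \<epsilon>\<^sup>2) * L2norm Omega (grad f))"
      using 1 2 3 by blast
  qed
qed

end
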